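(* For set supercompositions $I$ and $J$, $$Q_IQ_J=\sum_{K\in\operatorname{SSh}(I,J)}\operatorname{sgn}(K)\,Q_K.$$
   Context: $\mathbb{Q}^\theta\langle\langle x\rangle\rangle$: bounded-degree formal power series over $\mathbb{Q}$ in noncommuting $x_1,x_2,\ldots$ and $\theta_1,\theta_2,\ldots$ with $x_i\theta_j=\theta_jx_i$, $\theta_i\theta_j=-\theta_j\theta_i$. A set supercomposition of bidegree $(n,m)$ is a sequence $(I_1,\ldots,I_h)$ of nonempty subsets of $\{0,\ldots,n\}$ with $I_i\cap I_j\subseteq\{0\}$ ($i\ne j$), $\bigcup(I_i\setminus\{0\})=[n]$, $m$ blocks containing $0$ (fermionic). For a monic monomial $u$, relabel its index set order-preservingly onto $[k]$ to get $\theta_{i_1}\cdots\theta_{i_m}x_{j_1}\cdots x_{j_n}$ ($i_1<\cdots<i_m$), and set $I(u)=(I_1,\ldots,I_k)$ with $I_r=\{t:j_t=r\}\cup(\{0\}$ if $r\in\{i_1,\ldots,i_m\})$; $M_I=\sum_{I(u)=I}u$. Order: $J$ covers $I$ if $J$ arises by replacing two consecutive non-fermionic blocks $I_i,I_{i+1}$ with $\max I_i<\min I_{i+1}$ by $I_i\cup I_{i+1}$; $\preceq$ is the reflexive-transitive closure. $Q_I=\sum_{J\succeq I}M_J$. Super-shuffles: let $I=(I_1,\ldots,I_h)$ have bidegree $(n,m)$ and $J=(J_1,\ldots,J_k)$; $J[n]$ adds $n$ to every positive element of each block. An $(I,J)$-shuffle is an arrangement $L$ of the blocks of $I$ and $J[n]$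 preserving relative order within each; $\varepsilon(L)$ is the number of pairs of fermionic blocks $I_i,J_j[n]$ with $J_j[n]$ before $I_i$ in $L$. A sequence of consecutive non-fermionic blocks $(B_1,\ldots,B_r)$ is increasing if $\max B_i<\min B_{i+1}$ for all $i$. An $(I,J)$-super-shuffle is a set supercomposition obtained from an $(I,J)$-shuffle $L$ by a (possibly empty) collection of disjoint mergers, each replacing a run of consecutive blocks $L_p,\ldots,L_q$ of $L$ by their union, where either (1) $L_p$ is a fermionic block from $I$ and $L_{p+1},\ldots,L_q$ are blocks from $J[n]$ forming an increasing sequence, or (2) $L_q$ is a fermionic block from $J[n]$ and $L_p,\ldots,L_{q-1}$ are blocks from $I$ forming an increasing sequence. $\operatorname{SSh}(I,J)$ denotes their set, and $\operatorname{sgn}(K)=(-1)^{\varepsilon(L)}$ for the unique shuffle $L$ producing $K$.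
   Formalization: The sum runs over pairs (L,K) of a shuffle L and a super-shuffle K obtained from it, with sign (-1)^{ε(L)}, because L need not be unique: for I=J=({0}), K=({0},{0}) arises from two shuffles with opposite signs. When L is unique this is the stated formula. *)

theory Defs
  imports Complex_Main
begin

section \<open>Bounded-degree power series in \<open>x\<^sub>1, x\<^sub>2, \<dots>\<close> and \<open>\<theta>\<^sub>1, \<theta>\<^sub>2, \<dots>\<close>\<close>

text \<open>
  The pair \<open>(S, w)\<close> with \<open>S\<close> a finite set and \<open>w\<close> a list of positive indices encodes the monic
  monomial \<open>\<theta>\<^bsub>i1\<^esub> \<cdots> \<theta>\<^bsub>im\<^esub> x\<^bsub>j1\<^esub> \<cdots> x\<^bsub>jn\<^esub>\<close>, where \<open>i1 < \<dots> < im\<close> are the elements of \<open>S\<close> and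
  \<open>w = [j1, \<dots>, jn]\<close>. These monomials form a basis, so a series is a coefficient function on
  such pairs.
\<close>

definition is_monomial :: "nat set \<Rightarrow> nat list \<Rightarrow> bool" where
  "is_monomial S w \<longleftrightarrow> finite S \<and> 0 \<notin> S \<and> 0 \<notin> set w"

typedef superseries =
  "{f :: nat set \<Rightarrow> nat list \<Rightarrow> rat.
      \<exists>d. \<forall>S w. f S w \<noteq> 0 \<longrightarrow> is_monomial S w \<and> card S + length w \<le> d}"
  morphisms coeff Abs_superseries
  by (rule exI[of _ "\<lambda>_ _. 0"]) simp

setup_lifting type_definition_superseries

text \<open>
  For disjoint \<open>S\<close> and \<open>T\<close>, sorting the product of \<open>\<theta>\<^sub>S\<close> and \<open>\<theta>\<^sub>T\<close> into increasing order costs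
  one sign per inversion.
\<close>

definition theta_sign :: "nat set \<Rightarrow> nat set \<Rightarrow> rat" where
  "theta_sign S T = (-1) ^ card {(s, t). s \<in> S \<and> t \<in> T \<and> t < s}"

lemma theta_sign_empty [simp]: "theta_sign {} T = 1" "theta_sign S {} = 1"
  by (simp_all add: theta_sign_def)

lemma finite_inversions:
  "finite S \<Longrightarrow> finite T \<Longrightarrow> finite {(s, t). s \<in> S \<and> t \<in> T \<and> t < (s::nat)}"
  by (rule finite_subset[of _ "S \<times> T"]) auto

lemma theta_sign_Un_left:
  assumes "finite A" "finite B" "finite C" "A \<inter> B = {}"
  shows "theta_sign (A \<union> B) C = theta_sign A C * theta_sign B C"
proof -
  have "{(s, t). s \<in> A \<union> B \<and> t \<in> C \<and> t < s} =
      {(s, t). s \<in> A \<and> t \<in> C \<and> t < s} \<union> {(s, t). s \<in> B \<and> t \<in> C \<and> t < s}" by auto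
  moreover have "{(s, t). s \<in> A \<and> t \<in> C \<and> t < s} \<inter> {(s, t). s \<in> B \<and> t \<in> C \<and> t < s} = {}"
    using assms(4) by auto
  ultimately show ?thesis
    unfolding theta_sign_def
    using assms by (simp only: card_Un_disjoint finite_inversions power_add)
qed

lemma theta_sign_Un_right:
  assumes "finite A" "finite B" "finite C" "B \<inter> C = {}"
  shows "theta_sign A (B \<union> C) = theta_sign A B * theta_sign A C"
proof -
  have "{(s, t). s \<in> A \<and> t \<in> B \<union> C \<and> t < s} =
      {(s, t). s \<in> A \<and> t \<in> B \<and> t < s} \<union> {(s, t). s \<in> A \<and> t \<in> C \<and> t < s}" by auto
  moreover have "{(s, t). s \<in> A \<and> t \<in> B \<and> t < s} \<inter> {(s, t). s \<in> A \<and> t \<in> C \<and> t < s} = {}"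
    using assms(4) by auto
  ultimately show ?thesis
    unfolding theta_sign_def
    using assms by (simp only: card_Un_disjoint finite_inversions power_add)
qed

instantiation superseries :: ab_group_add
begin

lift_definition zero_superseries :: superseries is "\<lambda>_ _. 0" by simp

lift_definition plus_superseries :: "superseries \<Rightarrow> superseries \<Rightarrow> superseries"
  is "\<lambda>f g S w. f S w + g S w"
proof -
  fix f g :: "nat set \<Rightarrow> nat list \<Rightarrow> rat"
  assume "\<exists>d. \<forall>S w. f S w \<noteq> 0 \<longrightarrow> is_monomial S w \<and> card S + length w \<le> d"
    and "\<exists>d. \<forall>S w. g S w \<noteq> 0 \<longrightarrow> is_monomial S w \<and> card S + length w \<le> d"
  then obtain d e where
    "\<And>S w. f S w \<noteq> 0 \<Longrightarrow> is_monomial S w \<and> card S + length w \<le> d"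
    "\<And>S w. g S w \<noteq> 0 \<Longrightarrow> is_monomial S w \<and> card S + length w \<le> e" by blast
  then show "\<exists>d. \<forall>S w. f S w + g S w \<noteq> 0 \<longrightarrow> is_monomial S w \<and> card S + length w \<le> d"
    by (intro exI[of _ "max d e"]) (metis add_0 le_max_iff_disj)
qed

lift_definition uminus_superseries :: "superseries \<Rightarrow> superseries"
  is "\<lambda>f S w. - f S w" by simp

definition minus_superseries :: "superseries \<Rightarrow> superseries \<Rightarrow> superseries" where
  "minus_superseries f g = f + - g"

instance
proof
  fix f g h :: superseries
  show "f + g + h = f + (g + h)" by transfer (simp add: add.assoc)
  show "f + g = g + f" by transfer (simp add: add.commute)
  show "0 + f = f" by transfer simp
  show "- f + f = 0" by transfer simp
  show "f - g = f + - g" by (simp add: minus_superseries_def)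
qed

end

instantiation superseries :: ring_1
begin

lift_definition one_superseries :: superseries
  is "\<lambda>S w. if S = {} \<and> w = [] then 1 else 0"
  by (auto simp: is_monomial_def)

lift_definition times_superseries :: "superseries \<Rightarrow> superseries \<Rightarrow> superseries"
  is "\<lambda>f g S w. \<Sum>T\<in>Pow S. \<Sum>k\<le>length w.
        theta_sign T (S - T) * f T (take k w) * g (S - T) (drop k w)"
proof -
  fix f g :: "nat set \<Rightarrow> nat list \<Rightarrow> rat"
  assume "\<exists>d. \<forall>S w. f S w \<noteq> 0 \<longrightarrow> is_monomial S w \<and> card S + length w \<le> d"
    and "\<exists>d. \<forall>S w. g S w \<noteq> 0 \<longrightarrow> is_monomial S w \<and> card S + length w \<le> d"
  then obtain d e where
    f: "\<And>S w. f S w \<noteq> 0 \<Longrightarrow> is_monomial S w \<and> card S + length w \<le> d" and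
    g: "\<And>S w. g S w \<noteq> 0 \<Longrightarrow> is_monomial S w \<and> card S + length w \<le> e" by blast
  have "is_monomial S w \<and> card S + length w \<le> d + e"
    if nz: "(\<Sum>T\<in>Pow S. \<Sum>k\<le>length w.
        theta_sign T (S - T) * f T (take k w) * g (S - T) (drop k w)) \<noteq> 0" for S w
  proof -
    from nz obtain T where T: "T \<subseteq> S"
      "(\<Sum>k\<le>length w. theta_sign T (S - T) * f T (take k w) * g (S - T) (drop k w)) \<noteq> 0"
      by (meson PowD sum.not_neutral_contains_not_neutral)
    then obtain k where k: "k \<le> length w"
      "theta_sign T (S - T) * f T (take k w) * g (S - T) (drop k w) \<noteq> 0"
      by (meson atMost_iff sum.not_neutral_contains_not_neutral)
    have F: "is_monomial T (take k w)" "card T + length (take k w) \<le> d"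
      using f[of T "take k w"] k by auto
    have G: "is_monomial (S - T) (drop k w)" "card (S - T) + length (drop k w) \<le> e"
      using g[of "S - T" "drop k w"] k by auto
    have S: "S = T \<union> (S - T)" using T by auto
    have "card S = card T + card (S - T)"
      using F G T by (subst S, subst card_Un_disjoint) (auto simp: is_monomial_def)
    moreover have "set w = set (take k w) \<union> set (drop k w)"
      by (metis append_take_drop_id set_append)
    ultimately show ?thesis
      using F G k T unfolding is_monomial_def by auto
  qed
  then show "\<exists>d. \<forall>S w. (\<Sum>T\<in>Pow S. \<Sum>k\<le>length w.
        theta_sign T (S - T) * f T (take k w) * g (S - T) (drop k w)) \<noteq> 0 \<longrightarrow>
      is_monomial S w \<and> card S + length w \<le> d" by blast
qed

lemma coeff_infinite: "infinite S \<Longrightarrow> coeff f S w = 0"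
  by transfer (auto simp: is_monomial_def)

lemma superseries_times_assoc: "f * g * h = f * (g * h)" for f g h :: superseries
proof -
  define F G H where [simp]: "F = coeff f" "G = coeff g" "H = coeff h"
  have "coeff (f * g * h) S w = coeff (f * (g * h)) S w" for S w
  proof (cases "finite S")
    case False
    then show ?thesis by (simp add: coeff_infinite)
  next
    case True
    have "coeff (f * g * h) S w =
        (\<Sum>T\<in>Pow S. \<Sum>k\<le>length w. \<Sum>U\<in>Pow T. \<Sum>l\<le>k.
          theta_sign T (S - T) * theta_sign U (T - U) *
          F U (take l w) * G (T - U) (drop l (take k w)) * H (S - T) (drop k w))"
      unfolding times_superseries.rep_eq sum_distrib_left sum_distrib_right
      by (intro sum.cong refl) (auto simp: min_def)
    then have L: "coeff (f * g * h) S w =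
        (\<Sum>(T, k)\<in>Pow S \<times> {..length w}. \<Sum>(U, l)\<in>Pow T \<times> {..k}.
          theta_sign T (S - T) * theta_sign U (T - U) *
          F U (take l w) * G (T - U) (drop l (take k w)) * H (S - T) (drop k w))"
      by (simp only: sum.cartesian_product)
    have "coeff (f * (g * h)) S w =
        (\<Sum>U\<in>Pow S. \<Sum>l\<le>length w. \<Sum>V\<in>Pow (S - U). \<Sum>k\<le>length w - l.
          theta_sign U (S - U) * theta_sign V (S - U - V) *
          F U (take l w) * G V (take k (drop l w)) * H (S - U - V) (drop (k + l) w))"
      unfolding times_superseries.rep_eq sum_distrib_left sum_distrib_right
      by (intro sum.cong refl) auto
    then have R: "coeff (f * (g * h)) S w =
        (\<Sum>(U, l)\<in>Pow S \<times> {..length w}. \<Sum>(V, k)\<in>Pow (S - U) \<times> {..length w - l}.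
          theta_sign U (S - U) * theta_sign V (S - U - V) *
          F U (take l w) * G V (take k (drop l w)) * H (S - U - V) (drop (k + l) w))"
      by (simp only: sum.cartesian_product)
    have sgn: "theta_sign T (S - T) * theta_sign U (T - U) =
        theta_sign U (S - U) * theta_sign (T - U) (S - U - (T - U))"
      if "T \<subseteq> S" "U \<subseteq> T" for T U
    proof -
      have fin: "finite T" "finite U" using that True by (auto intro: finite_subset)
      have "theta_sign T (S - T) = theta_sign U (S - T) * theta_sign (T - U) (S - T)"
        using theta_sign_Un_left[of U "T - U" "S - T"] fin True that
        by (simp add: Un_absorb1 Int_commute)
      moreover have "S - U = (T - U) \<union> (S - T)" using that by auto
      then have "theta_sign U (S - U) = theta_sign U (T - U) * theta_sign U (S - T)"
        using theta_sign_Un_right[of U "T - U" "S - T"] fin True by auto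
      moreover have "S - U - (T - U) = S - T" using that by auto
      ultimately show ?thesis by simp
    qed
    define A where "A = (SIGMA p : Pow S \<times> {..length w}. Pow (fst p) \<times> {..snd p})"
    define B where "B = (SIGMA p : Pow S \<times> {..length w}. Pow (S - fst p) \<times> {..length w - snd p})"
    define p where "p = (\<lambda>((T, k), (U, l)).
        theta_sign T (S - T) * theta_sign U (T - U) *
        F U (take l w) * G (T - U) (drop l (take k w)) * H (S - T) (drop k w))"
    define q where "q = (\<lambda>((U, l), (V, k)).
        theta_sign U (S - U) * theta_sign V (S - U - V) *
        F U (take l w) * G V (take k (drop l w)) * H (S - U - V) (drop (k + l) w))"
    define i where "i = (\<lambda>((U, l), (V, k)). ((U \<union> V :: nat set, k + l :: nat), (U, l)))"
    define j where "j = (\<lambda>((T, k), (U, l)). ((U, l), (T - U :: nat set, k - l :: nat)))"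
    have "coeff (f * g * h) S w = sum p A"
      unfolding L A_def p_def case_prod_beta using True
      by (intro sum.Sigma[unfolded case_prod_beta]) (auto intro: finite_subset)
    also have "\<dots> = sum q B"
    proof (rule sum.reindex_bij_witness[where i = i and j = j])
      fix a assume "a \<in> A"
      then obtain T k U l where a: "a = ((T, k), (U, l))"
        and *: "T \<subseteq> S" "k \<le> length w" "U \<subseteq> T" "l \<le> k" by (auto simp: A_def)
      have [simp]: "U \<union> T = T" using * by auto
      have [simp]: "S - U - (T - U) = S - T" using * by auto
      show "i (j a) = a" using * by (simp add: a i_def j_def)
      show "j a \<in> B" using * by (auto simp: a B_def j_def)
      show "q (j a) = p a" using * sgn[of T U] by (simp add: a j_def p_def q_def drop_take)
    next
      fix b assume "b \<in> B"
      then obtain V k U l where b: "b = ((U, l), (V, k))"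
        and *: "U \<subseteq> S" "l \<le> length w" "V \<subseteq> S - U" "k \<le> length w - l" by (auto simp: B_def)
      have [simp]: "U \<union> V - U = V" using * by auto
      show "j (i b) = b" using * by (simp add: b i_def j_def)
      show "i b \<in> A" using * by (auto simp: b A_def i_def)
    qed
    also have "\<dots> = coeff (f * (g * h)) S w"
      unfolding R B_def q_def case_prod_beta using True
      by (intro sum.Sigma[unfolded case_prod_beta, symmetric]) auto
    finally show ?thesis .
  qed
  then show ?thesis by (simp add: coeff_inject[symmetric] fun_eq_iff)
qed

instance
proof
  fix f g h :: superseries
  show "f * g * h = f * (g * h)" by (rule superseries_times_assoc)
  show "(f + g) * h = f * h + g * h"
    by transfer (simp add: algebra_simps sum.distrib)
  show "f * (g + h) = f * g + f * h"
    by transfer (simp add: algebra_simps sum.distrib)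
  show "1 * f = f"
  proof (transfer, intro ext)
    fix f :: "nat set \<Rightarrow> nat list \<Rightarrow> rat" and S w
    assume "\<exists>d. \<forall>S w. f S w \<noteq> 0 \<longrightarrow> is_monomial S w \<and> card S + length w \<le> d"
    then have inf: "infinite S \<Longrightarrow> f S w = 0" by (auto simp: is_monomial_def)
    have "(\<Sum>k\<le>length w. theta_sign T (S - T) *
          (if T = {} \<and> take k w = [] then 1 else 0) * f (S - T) (drop k w)) =
        (\<Sum>k\<le>length w. if k = 0 then if T = {} then f S w else 0 else 0)" for T
      by (rule sum.cong) auto
    then have "(\<Sum>T\<in>Pow S. \<Sum>k\<le>length w. theta_sign T (S - T) *
          (if T = {} \<and> take k w = [] then 1 else 0) * f (S - T) (drop k w)) =
        (\<Sum>T\<in>Pow S. if T = {} then f S w else 0)" by simp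
    also have "\<dots> = f S w" using inf by (cases "finite S") auto
    finally show "(\<Sum>T\<in>Pow S. \<Sum>k\<le>length w. theta_sign T (S - T) *
          (if T = {} \<and> take k w = [] then 1 else 0) * f (S - T) (drop k w)) = f S w" .
  qed
  show "f * 1 = f"
  proof (transfer, intro ext)
    fix f :: "nat set \<Rightarrow> nat list \<Rightarrow> rat" and S w
    assume "\<exists>d. \<forall>S w. f S w \<noteq> 0 \<longrightarrow> is_monomial S w \<and> card S + length w \<le> d"
    then have inf: "infinite S \<Longrightarrow> f S w = 0" by (auto simp: is_monomial_def)
    have "(\<Sum>k\<le>length w. theta_sign T (S - T) * f T (take k w) *
          (if S - T = {} \<and> drop k w = [] then 1 else 0)) =
        (\<Sum>k\<le>length w. if k = length w then if T = S then f S w else 0 else 0)"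
      if "T \<in> Pow S" for T
      using that by (intro sum.cong) auto
    then have "(\<Sum>T\<in>Pow S. \<Sum>k\<le>length w. theta_sign T (S - T) * f T (take k w) *
          (if S - T = {} \<and> drop k w = [] then 1 else 0)) =
        (\<Sum>T\<in>Pow S. if T = S then f S w else 0)" by simp
    also have "\<dots> = f S w" using inf by (cases "finite S") auto
    finally show "(\<Sum>T\<in>Pow S. \<Sum>k\<le>length w. theta_sign T (S - T) * f T (take k w) *
          (if S - T = {} \<and> drop k w = [] then 1 else 0)) = f S w" .
  qed
  show "(0 :: superseries) \<noteq> 1" by transfer (auto dest!: fun_cong[of _ _ "{}"] fun_cong[of _ _ "[]"])
qed

end
lift_definition monomial :: "nat set \<Rightarrow> nat list \<Rightarrow> superseries"
  is "\<lambda>S w T v. if is_monomial S w \<and> T = S \<and> v = w then 1 else 0"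
  by auto

definition x_var :: "nat \<Rightarrow> superseries" where
  "x_var i = monomial {} [i]"

definition theta_var :: "nat \<Rightarrow> superseries" where
  "theta_var i = monomial {i} []"

lemma monomial_times:
  assumes "is_monomial S w" "is_monomial T v"
  shows "coeff (monomial S w * monomial T v) R u =
    (if S \<inter> T = {} \<and> R = S \<union> T \<and> u = w @ v then theta_sign S T else 0)"
proof (cases "finite R")
  case True
  have eq: "theta_sign A (R - A) * coeff (monomial S w) A (take k u) *
        coeff (monomial T v) (R - A) (drop k u) =
      (if A = S then if k = length w then
        if S \<inter> T = {} \<and> R = S \<union> T \<and> u = w @ v then theta_sign S T else 0 else 0 else 0)"
    if "A \<in> Pow R" "k \<in> {..length u}" for A k
  proof (cases "A = S \<and> take k u = w \<and> R - A = T \<and> drop k u = v")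
    case True
    then have "u = w @ v" "k = length w" "S \<inter> T = {}" "R = S \<union> T"
      using that by (auto simp: min_def)
    then show ?thesis using True assms by (auto simp: monomial.rep_eq)
  next
    case False
    have if3: "(if a then if b then if c then x else 0 else 0 else 0) = (0 :: rat)"
      if "\<not> (a \<and> b \<and> c)" for a b c x using that by auto
    from False have "coeff (monomial S w) A (take k u) = 0 \<or>
        coeff (monomial T v) (R - A) (drop k u) = 0" by (simp add: monomial.rep_eq)
    moreover have "\<not> (A = S \<and> k = length w \<and> S \<inter> T = {} \<and> R = S \<union> T \<and> u = w @ v)"
      using False by auto
    ultimately show ?thesis by (subst if3) auto
  qed
  have "coeff (monomial S w * monomial T v) R u = (\<Sum>A\<in>Pow R. \<Sum>k\<le>length u.
      if A = S then if k = length w then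
        if S \<inter> T = {} \<and> R = S \<union> T \<and> u = w @ v then theta_sign S T else 0 else 0 else 0)"
    unfolding times_superseries.rep_eq by (intro sum.cong refl eq)
  also have "\<dots> = (\<Sum>A\<in>Pow R. if A = S then \<Sum>k\<le>length u. if k = length w then
        if S \<inter> T = {} \<and> R = S \<union> T \<and> u = w @ v then theta_sign S T else 0 else 0 else 0)"
    by (intro sum.cong refl) simp
  also have "\<dots> = (if S \<inter> T = {} \<and> R = S \<union> T \<and> u = w @ v then theta_sign S T else 0)"
    using True by (simp add: sum.delta)
  finally show ?thesis .
next
  case False
  then show ?thesis using assms by (auto simp: coeff_infinite is_monomial_def)
qed

lemma superseries_eqI: "(\<And>S w. coeff f S w = coeff g S w) \<Longrightarrow> f = g"
  by (simp add: coeff_inject[symmetric] fun_eq_iff)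

lemma x_var_theta_var_commute:
  "i > 0 \<Longrightarrow> j > 0 \<Longrightarrow> x_var i * theta_var j = theta_var j * x_var i"
  by (rule superseries_eqI) (simp add: x_var_def theta_var_def monomial_times is_monomial_def)

lemma theta_var_anticommute:
  assumes "i > 0" "j > 0"
  shows "theta_var i * theta_var j = - (theta_var j * theta_var i)"
proof -
  have "{(s, t). s \<in> {a} \<and> t \<in> {b} \<and> t < s} = (if b < a then {(a, b)} else {})" for a b :: nat
    by auto
  then show ?thesis using assms
    by (intro superseries_eqI)
      (auto simp: theta_var_def monomial_times is_monomial_def uminus_superseries.rep_eq
        theta_sign_def)
qed


section \<open>Set supercompositions\<close>

definition set_supercomposition :: "nat \<Rightarrow> nat \<Rightarrow> nat set list \<Rightarrow> bool" where
  "set_supercomposition n m I \<longleftrightarrow>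
     (\<forall>B\<in>set I. B \<noteq> {} \<and> B \<subseteq> {0..n}) \<and>
     (\<forall>i<length I. \<forall>j<length I. i \<noteq> j \<longrightarrow> I ! i \<inter> I ! j \<subseteq> {0}) \<and>
     (\<Union>B\<in>set I. B - {0}) = {1..n} \<and>
     length (filter (\<lambda>B. 0 \<in> B) I) = m"

text \<open>The set supercomposition \<open>I(u)\<close> of the monic monomial \<open>u\<close> encoded by \<open>(S, w)\<close>.\<close>

definition relabel :: "nat set \<Rightarrow> nat \<Rightarrow> nat" where
  "relabel A i = card {a \<in> A. a \<le> i}"

definition monomial_comp :: "nat set \<Rightarrow> nat list \<Rightarrow> nat set list" where
  "monomial_comp S w =
     (let A = S \<union> set w; S' = relabel A ` S; w' = map (relabel A) w
      in map (\<lambda>r. {t \<in> {1..length w'}. w' ! (t - 1) = r} \<union> (if r \<in> S' then {0} else {}))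
           [1..<Suc (card A)])"

lemma monomial_comp_degree:
  assumes "is_monomial S w"
  shows "card S + length w \<le> length (monomial_comp S w) + card (\<Union>(set (monomial_comp S w)))"
proof -
  define A where "A = S \<union> set w"
  have fin: "finite A" using assms by (simp add: A_def is_monomial_def)
  have "{1..length w} \<subseteq> \<Union>(set (monomial_comp S w))"
  proof
    fix t assume t: "t \<in> {1..length w}"
    define r where "r = relabel A (w ! (t - 1))"
    have "w ! (t - 1) \<in> A" using t by (auto simp: A_def)
    then have "r \<noteq> 0" using fin by (auto simp: r_def relabel_def)
    moreover have "r \<le> card A" using fin by (auto simp: r_def relabel_def intro!: card_mono)
    moreover have "map (relabel A) w ! (t - 1) = r" using t by (auto simp: r_def)
    ultimately show "t \<in> \<Union>(set (monomial_comp S w))"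
      using t unfolding monomial_comp_def Let_def A_def[symmetric]
      by (auto intro!: bexI[of _ r])
  qed
  moreover have "finite (\<Union>(set (monomial_comp S w)))"
    by (auto simp: monomial_comp_def Let_def)
  ultimately have "card {1..length w} \<le> card (\<Union>(set (monomial_comp S w)))"
    by (rule card_mono[rotated])
  moreover have "card S \<le> length (monomial_comp S w)"
    using fin by (simp add: monomial_comp_def Let_def A_def card_mono del: upt_Suc)
  ultimately show ?thesis by simp
qed

lift_definition M :: "nat set list \<Rightarrow> superseries"
  is "\<lambda>I S w. if is_monomial S w \<and> monomial_comp S w = I then 1 else 0"
proof -
  fix I
  show "\<exists>d. \<forall>S w. (if is_monomial S w \<and> monomial_comp S w = I then 1 else (0 :: rat)) \<noteq> 0 \<longrightarrow>
      is_monomial S w \<and> card S + length w \<le> d"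
    using monomial_comp_degree by (intro exI[of _ "length I + card (\<Union>(set I))"]) auto
qed

definition covered_by :: "nat set list \<Rightarrow> nat set list \<Rightarrow> bool" where
  "covered_by I J \<longleftrightarrow>
     (\<exists>P B C R. I = P @ [B, C] @ R \<and> 0 \<notin> B \<and> 0 \<notin> C \<and> Max B < Min C \<and> J = P @ [B \<union> C] @ R)"

definition preceq :: "nat set list \<Rightarrow> nat set list \<Rightarrow> bool" where
  "preceq = covered_by\<^sup>*\<^sup>*"

definition Q :: "nat set list \<Rightarrow> superseries" where
  "Q I = (\<Sum>J | preceq I J. M J)"

lemma finite_preceq: "finite {J. preceq I J}"
proof (induction "length I" arbitrary: I rule: less_induct)
  case less
  have "{J. covered_by I J} \<subseteq>
      (\<lambda>k. take k I @ [I ! k \<union> I ! Suc k] @ drop (k + 2) I) ` {..length I}"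
  proof
    fix J assume "J \<in> {J. covered_by I J}"
    then obtain P B C R where "I = P @ [B, C] @ R" "J = P @ [B \<union> C] @ R"
      by (auto simp: covered_by_def)
    then show "J \<in> (\<lambda>k. take k I @ [I ! k \<union> I ! Suc k] @ drop (k + 2) I) ` {..length I}"
      by (intro image_eqI[of _ _ "length P"]) (auto simp: nth_append)
  qed
  then have "finite {J. covered_by I J}" by (rule finite_subset) simp
  moreover have "finite {K. preceq J K}" if "covered_by I J" for J
    using that by (intro less) (auto simp: covered_by_def)
  moreover have "{J. preceq I J} = insert I (\<Union>J\<in>{J. covered_by I J}. {K. preceq J K})"
    by (auto simp: preceq_def elim: converse_rtranclpE intro: converse_rtranclp_into_rtranclp)
  ultimately show ?case by auto
qed


section \<open>Super-shuffles\<close>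

definition shift :: "nat \<Rightarrow> nat set list \<Rightarrow> nat set list" where
  "shift n J = map (\<lambda>B. (\<lambda>a. if a = 0 then 0 else a + n) ` B) J"

text \<open>
  The tags \<open>Inl\<close> and \<open>Inr\<close> record whether a block of an arrangement comes from \<open>I\<close> or from
  \<open>J[n]\<close>; they matter because both may contain the block \<open>{0}\<close>.
\<close>

type_synonym arrangement = "(nat set + nat set) list"

definition block :: "nat set + nat set \<Rightarrow> nat set" where
  "block b = case_sum id id b"

definition arrangements :: "nat \<Rightarrow> nat set list \<Rightarrow> nat set list \<Rightarrow> arrangement set" where
  "arrangements n I J = shuffles (map Inl I) (map Inr (shift n J))"

definition eps :: "arrangement \<Rightarrow> nat" where
  "eps L = card {(p, q). p < q \<and> q < length L \<and>
     (\<exists>B C. L ! p = Inr B \<and> L ! q = Inl C \<and> 0 \<in> B \<and> 0 \<in> C)}"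

definition increasing :: "nat set list \<Rightarrow> bool" where
  "increasing Bs \<longleftrightarrow> (\<forall>B\<in>set Bs. 0 \<notin> B) \<and> successively (\<lambda>B C. Max B < Min C) Bs"

definition mergeable :: "arrangement \<Rightarrow> bool" where
  "mergeable R \<longleftrightarrow>
     (\<exists>F Bs. R = Inl F # map Inr Bs \<and> 0 \<in> F \<and> Bs \<noteq> [] \<and> increasing Bs) \<or>
     (\<exists>F Bs. R = map Inl Bs @ [Inr F] \<and> 0 \<in> F \<and> Bs \<noteq> [] \<and> increasing Bs)"

text \<open>
  A collection of disjoint mergers in \<open>L\<close> is a division of \<open>L\<close> into consecutive runs \<open>Rs\<close>, each of
  which is a single (unmerged) block or one of the runs that may be merged.
\<close>

definition produces :: "arrangement \<Rightarrow> nat set list \<Rightarrow> bool" where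
  "produces L K \<longleftrightarrow>
     (\<exists>Rs. concat Rs = L \<and> (\<forall>R\<in>set Rs. length R = 1 \<or> mergeable R) \<and>
           K = map (\<lambda>R. \<Union>(block ` set R)) Rs)"

text \<open>
  A super-shuffle is recorded as the pair \<open>(L, K)\<close> of the resulting set supercomposition \<open>K\<close> and the
  arrangement \<open>L\<close> producing it, and its sign is \<open>(-1) ^ eps L\<close>. If both \<open>I\<close> and \<open>J\<close> have a block
  \<open>{0}\<close>, the same \<open>K\<close> can arise from several \<open>L\<close>, with different signs: for \<open>I = J = [{0}]\<close> both
  arrangements give \<open>[{0}, {0}]\<close>, and their contributions cancel, as they must because
  \<open>Q [{0}] * Q [{0}] = 0\<close>. Such super-shuffles have to be counted separately. When every \<open>K\<close> has
  only one \<open>L\<close>, the lemma \<open>sum_SSh_unique\<close> turns sums over pairs into sums over the set of the \<open>K\<close>.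
\<close>

definition SSh :: "nat \<Rightarrow> nat set list \<Rightarrow> nat set list \<Rightarrow> (arrangement \<times> nat set list) set" where
  "SSh n I J = {(L, K). L \<in> arrangements n I J \<and> produces L K}"

lemma sum_SSh_unique:
  fixes f :: "nat set list \<Rightarrow> superseries"
  assumes "\<And>K. K \<in> snd ` SSh n I J \<Longrightarrow> \<exists>!L. (L, K) \<in> SSh n I J"
  shows "(\<Sum>(L, K)\<in>SSh n I J. (-1) ^ eps L * f K) =
    (\<Sum>K\<in>snd ` SSh n I J. (-1) ^ eps (THE L. (L, K) \<in> SSh n I J) * f K)"
proof -
  have inj: "inj_on snd (SSh n I J)"
  proof (rule inj_onI)
    fix p q assume "p \<in> SSh n I J" "q \<in> SSh n I J" "snd p = snd q"
    then show "p = q" using assms[of "snd p"] by (metis imageI prod.collapse)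
  qed
  show ?thesis
  proof (simp add: sum.reindex[OF inj] case_prod_beta, rule sum.cong[OF refl])
    fix p assume p: "p \<in> SSh n I J"
    then have "(THE L. (L, snd p) \<in> SSh n I J) = fst p"
      using assms[of "snd p"] by (intro the1_equality) auto
    then show "(-1) ^ eps (fst p) * f (snd p) =
        (-1) ^ eps (THE L. (L, snd p) \<in> SSh n I J) * f (snd p)" by simp
  qed
qed

lemma finite_SSh: "finite (SSh n I J)"
proof -
  have "finite {K. produces L K}" for L
  proof -
    define X where "X = {R. set R \<subseteq> set L \<and> length R \<le> length L}"
    have "{K. produces L K} \<subseteq> map (\<lambda>R. \<Union>(block ` set R)) ` {Rs. set Rs \<subseteq> X \<and> length Rs \<le> length L}"
    proof
      fix K assume "K \<in> {K. produces L K}"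
      then obtain Rs where Rs: "concat Rs = L" "\<forall>R\<in>set Rs. length R = 1 \<or> mergeable R"
        and K: "K = map (\<lambda>R. \<Union>(block ` set R)) Rs" by (auto simp: produces_def)
      have "1 \<le> length R" if "R \<in> set Rs" for R
        using Rs(2) that by (force simp: mergeable_def)
      then have "length Rs \<le> length L"
        using sum_list_mono[of Rs "\<lambda>_. 1" length] by (simp add: Rs(1)[symmetric] length_concat sum_list_triv)
      moreover have "R \<in> X" if "R \<in> set Rs" for R
        using that by (auto simp: X_def Rs(1)[symmetric] length_concat intro!: member_le_sum_list)
      ultimately show "K \<in> map (\<lambda>R. \<Union>(block ` set R)) ` {Rs. set Rs \<subseteq> X \<and> length Rs \<le> length L}"
        using K by blast
    qed
    moreover have "finite X" unfolding X_def by (rule finite_lists_length_le) simp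
    then have "finite {Rs. set Rs \<subseteq> X \<and> length Rs \<le> length L}"
      by (rule finite_lists_length_le)
    ultimately show ?thesis by (blast intro: finite_subset)
  qed
  moreover have "SSh n I J = (SIGMA L : arrangements n I J. {K. produces L K})"
    by (auto simp: SSh_def)
  ultimately show ?thesis by (simp add: arrangements_def finite_SigmaI)
qed

end

(*
  Fix a monomial and record, for each index r, its level: the set of positions t with j_t = r,
  together with 0 if theta_r occurs. The monomial occurs in Q_I exactly when I can be cut into
  consecutive segments, one for each r, whose unions are the levels, where a segment is empty, a
  single block, or an increasing run of non-fermionic blocks; such a cutting is unique. A term of
  Q_I Q_J therefore consists of a segment s of I and a segment t of J[n] for each r, not both
  fermionic. Writing s before t on every level gives an arrangement L, and merging s with t on the
  levels where exactly one of them is fermionic and neither is empty gives a super-shuffle K whose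
  Q_K contains the monomial. Every occurrence of the monomial on the right-hand side arises from
  exactly one such choice, because all positive elements of J[n] exceed those of I: in an
  increasing run the blocks of I precede those of J[n]. Both signs count the pairs of levels r < r'
  with fermionic t_r and s_r'.
*)
theory Submission
  imports Defs
begin

section \<open>Segmentations\<close>

abbreviation unions :: "nat set list list \<Rightarrow> nat set list" where
  "unions \<equiv> map (\<lambda>s. \<Union>(set s))"

text \<open>For finite nonempty blocks this is the comparison \<open>Max B < Min C\<close>; the
  quantified form passes directly to unions and images.\<close>

definition set_less :: "nat set \<Rightarrow> nat set \<Rightarrow> bool" where
  "set_less B C \<longleftrightarrow> (\<forall>b\<in>B. \<forall>c\<in>C. b < c)"

text \<open>A segment supplying one level: empty when the index does not occur, a single block of
  either kind, or an increasing run of non-fermionic blocks. Comparing all pairs instead of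
  neighbours makes the condition easy to split and concatenate.\<close>

definition good :: "nat set list \<Rightarrow> bool" where
  "good s \<longleftrightarrow> length s \<le> 1 \<or> 0 \<notin> \<Union>(set s) \<and> sorted_wrt set_less s"

text \<open>Empty segments are allowed, so that \<open>G\<close> may contain empty levels.\<close>

definition segmented :: "nat set list \<Rightarrow> nat set list \<Rightarrow> bool" where
  "segmented I G \<longleftrightarrow> (\<exists>Ss. concat Ss = I \<and> unions Ss = G \<and> (\<forall>s\<in>set Ss. good s))"

lemma Max_less_Min_iff:
  "finite B \<Longrightarrow> B \<noteq> {} \<Longrightarrow> finite C \<Longrightarrow> C \<noteq> {} \<Longrightarrow> Max B < Min C \<longleftrightarrow> set_less B C"
  by (auto simp: set_less_def)

lemma increasing_iff:
  assumes "\<forall>B\<in>set s. finite B \<and> B \<noteq> {}"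
  shows "increasing s \<longleftrightarrow> 0 \<notin> \<Union>(set s) \<and> sorted_wrt set_less s"
proof -
  \<comment> \<open>Nonemptiness is put into \<open>P\<close> because \<open>set_less\<close> alone
    is not transitive through an empty set.\<close>
  define P where "P = (\<lambda>B C. finite B \<and> B \<noteq> {} \<and> finite C \<and> C \<noteq> {} \<and> set_less B C)"
  have "transp P"
    unfolding transp_def P_def set_less_def by (metis all_not_in_conv less_trans)
  have "Max B < Min C \<longleftrightarrow> P B C" if "B \<in> set s" "C \<in> set s" for B C
    unfolding P_def using assms that Max_less_Min_iff[of B C] by blast
  then have "successively (\<lambda>B C. Max B < Min C) s \<longleftrightarrow> successively P s"
    by (intro successively_cong) auto
  also have "\<dots> \<longleftrightarrow> sorted_wrt P s"
    by (rule successively_conv_sorted_wrt) fact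
  also have "\<dots> \<longleftrightarrow> sorted_wrt set_less s"
    using assms by (auto simp: P_def sorted_wrt_iff_nth_less)
  finally show ?thesis by (auto simp: increasing_def)
qed

lemma good_Nil [simp]: "good []" and good_single [simp]: "good [B]"
  by (simp_all add: good_def)

lemma good_with_0: "good s \<Longrightarrow> 0 \<in> \<Union>(set s) \<Longrightarrow> \<exists>F. s = [F] \<and> 0 \<in> F"
  by (cases s) (auto simp: good_def)

lemma good_without_0: "0 \<notin> \<Union>(set s) \<Longrightarrow> good s \<longleftrightarrow> sorted_wrt set_less s"
  by (cases s) (auto simp: good_def)

lemma length_filter_good:
  "good s \<Longrightarrow> length (filter (\<lambda>B. 0 \<in> B) s) = (if 0 \<in> \<Union>(set s) then 1 else 0)"
  by (auto dest: good_with_0)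

subsection \<open>The order in terms of segmentations\<close>

lemma preceq_trans: "preceq I J \<Longrightarrow> preceq J K \<Longrightarrow> preceq I K"
  by (simp add: preceq_def)

text \<open>Merge the first two blocks and induct on the length: their union still lies below every
  later block, so the shorter list is again good.\<close>

lemma preceq_merge:
  assumes "s \<noteq> []" "\<forall>B\<in>set s. finite B \<and> B \<noteq> {}" "good s"
  shows "preceq (P @ s @ R) (P @ [\<Union>(set s)] @ R)"
  using assms
proof (induction "length s" arbitrary: s)
  case (Suc k)
  show ?case
  proof (cases s rule: remdups_adj.cases)
    case (3 B C s')
    have *: "0 \<notin> \<Union>(set s)" "sorted_wrt set_less s" using Suc.prems 3 by (auto simp: good_def)
    have "covered_by (P @ s @ R) (P @ ((B \<union> C) # s') @ R)"
      unfolding covered_by_def using * Suc.prems 3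
      by (intro exI[of _ P] exI[of _ B] exI[of _ C] exI[of _ "s' @ R"])
        (simp add: Max_less_Min_iff del: Max_less_iff Min_gr_iff)
    moreover have "preceq (P @ ((B \<union> C) # s') @ R) (P @ [\<Union>(set ((B \<union> C) # s'))] @ R)"
      using Suc.hyps(2) Suc.prems * 3
      by (intro Suc.hyps(1)) (auto simp: good_def set_less_def)
    moreover have "\<Union>(set ((B \<union> C) # s')) = \<Union>(set s)" by (auto simp: 3)
    ultimately show ?thesis by (simp add: preceq_def converse_rtranclp_into_rtranclp)
  qed (use Suc in \<open>auto simp: preceq_def\<close>)
qed auto

text \<open>A further cover joins two adjacent unions; neither contains 0 and one lies below the
  other, so their segments concatenate to a good segment. Conversely the segments can be merged one
  after the other.\<close>

lemma preceq_iff: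
  assumes "\<forall>B\<in>set I. finite B \<and> B \<noteq> {}"
  shows "preceq I J \<longleftrightarrow> (\<exists>Ss. concat Ss = I \<and> unions Ss = J \<and> (\<forall>s\<in>set Ss. good s \<and> s \<noteq> []))"
proof
  assume "preceq I J"
  then show "\<exists>Ss. concat Ss = I \<and> unions Ss = J \<and> (\<forall>s\<in>set Ss. good s \<and> s \<noteq> [])"
    unfolding preceq_def
  proof (induction rule: rtranclp_induct)
    case base
    have "concat (map (\<lambda>B. [B]) I) = I" "unions (map (\<lambda>B. [B]) I) = I"
      by (induction I) auto
    then show ?case by (intro exI[of _ "map (\<lambda>B. [B]) I"]) auto
  next
    case (step J K)
    then obtain Ss where Ss: "concat Ss = I" "unions Ss = J"
      "\<forall>s\<in>set Ss. good s \<and> s \<noteq> []" by blast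
    obtain P B C R where *: "J = P @ [B, C] @ R" "0 \<notin> B" "0 \<notin> C" "Max B < Min C"
      "K = P @ [B \<union> C] @ R" using step.hyps(2) by (auto simp: covered_by_def)
    obtain SP b c SR where S: "Ss = SP @ [b, c] @ SR" "unions SP = P" "\<Union>(set b) = B"
      "\<Union>(set c) = C" "unions SR = R"
      using Ss(2) unfolding *(1) by (auto simp: map_eq_append_conv Cons_eq_map_conv)
    have bc: "good b" "good c" "b \<noteq> []" "c \<noteq> []" using Ss(3) S(1) by auto
    have "set b \<union> set c \<subseteq> set I" by (auto simp: Ss(1)[symmetric] S(1))
    then have fin: "\<And>D. D \<in> set b \<union> set c \<Longrightarrow> finite D \<and> D \<noteq> {}" using assms by blast
    have "finite B" "finite C" unfolding S(3,4)[symmetric] using fin by auto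
    moreover have "B \<noteq> {}" "C \<noteq> {}"
      unfolding S(3,4)[symmetric] using bc(3,4) fin hd_in_set by (metis UnCI Union_empty_conv)+
    ultimately have "set_less B C" using *(4) Max_less_Min_iff[of B C] by blast
    then have "\<forall>x\<in>set b. \<forall>y\<in>set c. set_less x y"
      using S(3,4) by (auto simp: set_less_def)
    moreover have "sorted_wrt set_less b" "sorted_wrt set_less c"
      using bc *(2,3) S(3,4) by (auto simp: good_without_0)
    ultimately have "good (b @ c)"
      using *(2,3) S(3,4) by (subst good_without_0) (auto simp: sorted_wrt_append)
    then show ?case using Ss S *(5) bc
      by (intro exI[of _ "SP @ [b @ c] @ SR"]) auto
  qed
next
  assume "\<exists>Ss. concat Ss = I \<and> unions Ss = J \<and> (\<forall>s\<in>set Ss. good s \<and> s \<noteq> [])"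
  then obtain Ss where Ss: "concat Ss = I" "unions Ss = J" "\<forall>s\<in>set Ss. good s \<and> s \<noteq> []"
    by blast
  \<comment> \<open>\<open>P\<close> holds the blocks already merged, so that the induction can work
    through the segments from left to right.\<close>
  have "preceq (P @ concat Ss) (P @ unions Ss)" if "\<forall>s\<in>set Ss. good s \<and> s \<noteq> []"
    "\<forall>B\<in>set (concat Ss). finite B \<and> B \<noteq> {}" for P
    using that
  proof (induction Ss arbitrary: P)
    case Nil
    then show ?case by (simp add: preceq_def)
  next
    case (Cons s Ss)
    have "preceq (P @ s @ concat Ss) (P @ [\<Union>(set s)] @ concat Ss)"
      using Cons.prems by (intro preceq_merge) auto
    moreover have "preceq ((P @ [\<Union>(set s)]) @ concat Ss) ((P @ [\<Union>(set s)]) @ unions Ss)"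
      using Cons.prems by (intro Cons.IH) auto
    ultimately show ?case using preceq_trans by fastforce
  qed
  from this[of "[]"] show "preceq I J" using Ss assms by auto
qed

text \<open>Blocks are nonempty, so only empty segments have empty union; inserting or deleting
  these matches inserting or deleting empty sets in \<open>G\<close>. Together with
  \<open>monomial_comp_levels\<close> this disposes of the relabelling of indices.\<close>

lemma preceq_iff_segmented:
  assumes "\<forall>B\<in>set I. finite B \<and> B \<noteq> {}"
  shows "preceq I (filter (\<lambda>B. B \<noteq> {}) G) \<longleftrightarrow> segmented I G"
proof
  assume "preceq I (filter (\<lambda>B. B \<noteq> {}) G)"
  then obtain Ss where Ss: "concat Ss = I" "unions Ss = filter (\<lambda>B. B \<noteq> {}) G"
    "\<forall>s\<in>set Ss. good s" using assms by (auto simp: preceq_iff)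
  have "\<exists>Ts. concat Ts = concat Ss \<and> unions Ts = G \<and> (\<forall>s\<in>set Ts. good s)"
    using Ss(2,3)
  proof (induction G arbitrary: Ss)
    case (Cons g G)
    show ?case
    proof (cases "g = {}")
      case True
      then obtain Ts where "concat Ts = concat Ss" "unions Ts = G" "\<forall>s\<in>set Ts. good s"
        using Cons.IH[of Ss] Cons.prems by auto
      then show ?thesis using True by (intro exI[of _ "[] # Ts"]) auto
    next
      case False
      then obtain s Ss' where S: "Ss = s # Ss'" "\<Union>(set s) = g"
        "unions Ss' = filter (\<lambda>B. B \<noteq> {}) G" using Cons.prems(1) by (cases Ss) auto
      then obtain Ts where "concat Ts = concat Ss'" "unions Ts = G" "\<forall>s\<in>set Ts. good s"
        using Cons.IH[of Ss'] Cons.prems(2) by auto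
      then show ?thesis using S Cons.prems(2) by (intro exI[of _ "s # Ts"]) auto
    qed
  qed auto
  then show "segmented I G" using Ss(1) by (auto simp: segmented_def)
next
  assume "segmented I G"
  then obtain Ss where Ss: "concat Ss = I" "unions Ss = G" "\<forall>s\<in>set Ss. good s"
    by (auto simp: segmented_def)
  have "\<Union>(set s) = {} \<longleftrightarrow> s = []" if "s \<in> set Ss" for s
  proof -
    have "set s \<subseteq> set I" unfolding Ss(1)[symmetric] using that by auto
    then have "B \<noteq> {}" if "B \<in> set s" for B using assms that by blast
    then show ?thesis by (cases s) auto
  qed
  then have "filter (\<lambda>B. B \<noteq> {}) G = unions (filter (\<lambda>s. s \<noteq> []) Ss)"
    unfolding Ss(2)[symmetric] filter_map by (auto intro!: arg_cong[of _ _ unions] filter_cong)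
  moreover have "concat (filter (\<lambda>s. s \<noteq> []) Ss) = I"
    using Ss(1) by (induction Ss arbitrary: I) auto
  ultimately show "preceq I (filter (\<lambda>B. B \<noteq> {}) G)"
    unfolding preceq_iff[OF assms] using Ss(3)
    by (intro exI[of _ "filter (\<lambda>s. s \<noteq> []) Ss"]) auto
qed

subsection \<open>Uniqueness of segmentations\<close>

text \<open>The element 0 marks fermionic blocks and may be shared, hence intersections inside
  \<open>{0}\<close> rather than empty ones. Covering \<open>[n]\<close> is not part of the
  property, so it passes to sublists.\<close>

definition proper :: "nat set list \<Rightarrow> bool" where
  "proper I \<longleftrightarrow> (\<forall>B\<in>set I. finite B \<and> B \<noteq> {}) \<and> sorted_wrt (\<lambda>B C. B \<inter> C \<subseteq> {0}) I"

lemma proper_append: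
  "proper (I @ J) \<longleftrightarrow> proper I \<and> proper J \<and> (\<forall>B\<in>set I. \<forall>C\<in>set J. B \<inter> C \<subseteq> {0})"
  by (auto simp: proper_def sorted_wrt_append)

text \<open>
  The bound on the number of blocks containing 0 is needed because several blocks may equal
  \<open>{0}\<close>, so that disjointness alone does not detect a longer prefix.
\<close>

lemma prefix_unique:
  assumes "proper (map h (a @ e))" "\<Union>(h ` set (a @ e)) = \<Union>(h ` set a)"
    and "length (filter (\<lambda>x. 0 \<in> h x) (a @ e)) \<le> 1"
  shows "e = []"
proof (rule ccontr)
  assume "e \<noteq> []"
  then obtain y where y: "y \<in> set e" by (cases e) auto
  then obtain x where x: "x \<in> h y" using assms(1) by (auto simp: proper_def)
  then obtain z where z: "z \<in> set a" "x \<in> h z" using assms(2) y by auto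
  have "h z \<inter> h y \<subseteq> {0}" using assms(1) y z unfolding map_append proper_append by auto
  then have "0 \<in> h z" "0 \<in> h y" using x z by auto
  then have "filter (\<lambda>x. 0 \<in> h x) a \<noteq> []" "filter (\<lambda>x. 0 \<in> h x) e \<noteq> []"
    using y z by (auto simp: filter_empty_conv)
  then show False using assms(3)
    by (cases "filter (\<lambda>x. 0 \<in> h x) a"; cases "filter (\<lambda>x. 0 \<in> h x) e") auto
qed

text \<open>The two first segments are prefixes of one list with the same union, so neither is
  properly longer; then recurse. The map \<open>h\<close> is the identity for lists of blocks and
  \<open>block\<close> for arrangements.\<close>

lemma segmentation_unique:
  assumes "concat As = concat Bs" "map (\<lambda>a. \<Union>(h ` set a)) As = map (\<lambda>a. \<Union>(h ` set a)) Bs"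
    and "proper (map h (concat As))"
    and "\<forall>a\<in>set As \<union> set Bs. length (filter (\<lambda>x. 0 \<in> h x) a) \<le> 1"
  shows "As = Bs"
  using assms
proof (induction As arbitrary: Bs)
  case (Cons a As)
  obtain b Bs' where B: "Bs = b # Bs'" using Cons.prems(2) by (cases Bs) auto
  have eq: "a @ concat As = b @ concat Bs'" "\<Union>(h ` set a) = \<Union>(h ` set b)"
    using Cons.prems B by auto
  have pr: "proper (map h a)" "proper (map h b)" "proper (map h (concat As))"
    using Cons.prems(3) eq(1) by (metis concat.simps(2) map_append proper_append)+
  have zc: "length (filter (\<lambda>x. 0 \<in> h x) a) \<le> 1" "length (filter (\<lambda>x. 0 \<in> h x) b) \<le> 1"
    using Cons.prems(4) B by auto
  have "a = b"
    using eq(1) unfolding append_eq_append_conv2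
  proof (elim exE disjE conjE)
    fix e assume "a = b @ e" then show ?thesis using prefix_unique[of h b e] pr zc eq by auto
  next
    fix e assume "a @ e = b" then show ?thesis using prefix_unique[of h a e] pr zc eq by auto
  qed
  then show ?case using Cons.IH[of Bs'] Cons.prems B pr by auto
qed auto

section \<open>Coefficients of Q\<close>

text \<open>Positions are counted from 1, since 0 records the theta variable; list indices start at
  0, hence \<open>t - 1\<close>.\<close>

definition level :: "nat set \<Rightarrow> nat list \<Rightarrow> nat \<Rightarrow> nat set" where
  "level S w r = {t \<in> {1..length w}. w ! (t - 1) = r} \<union> (if r \<in> S then {0} else {})"

text \<open>
  Unlike \<open>monomial_comp\<close>, the list of levels keeps the empty ones, so that no relabelling of the
  indices is necessary.
\<close>

definition levels :: "nat \<Rightarrow> nat set \<Rightarrow> nat list \<Rightarrow> nat set list" where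
  "levels N S w = map (level S w) [1..<Suc N]"

lemma length_levels [simp]: "length (levels N S w) = N"
  by (simp add: levels_def)

lemma nth_levels: "i < N \<Longrightarrow> levels N S w ! i = level S w (Suc i)"
  by (simp add: levels_def del: upt_Suc)

lemma level_empty_iff: "level S w r = {} \<longleftrightarrow> r \<notin> S \<union> set w"
proof -
  have "r \<in> set w" if "t \<in> {1..length w}" "w ! (t - 1) = r" for t using that by auto
  moreover have "\<exists>t\<in>{1..length w}. w ! (t - 1) = r" if "r \<in> set w"
    using that unfolding in_set_conv_nth
    by (metis Suc_leI atLeastAtMost_iff diff_Suc_1 le_add1 plus_1_eq_Suc)
  ultimately show ?thesis by (auto simp: level_def)
qed

text \<open>The relabelling is increasing and takes the values \<open>1, ..., card A\<close>, so the
  relabelled levels are the nonempty original levels in the same order.\<close>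

lemma monomial_comp_levels:
  assumes "S \<union> set w \<subseteq> {1..N}"
  shows "monomial_comp S w = filter (\<lambda>B. B \<noteq> {}) (levels N S w)"
proof -
  define A where "A = S \<union> set w"
  define as where "as = sorted_list_of_set A"
  have fin: "finite A" using assms finite_subset by (auto simp: A_def)
  have as: "sorted_wrt (<) as" "set as = A" "length as = card A"
    using fin by (simp_all add: as_def)
  \<comment> \<open>\<open>Suc i\<close> because exactly the elements
    \<open>as ! 0, ..., as ! i\<close> of \<open>A\<close> are at most
    \<open>as ! i\<close>.\<close>
  have rank: "relabel A (as ! i) = Suc i" if "i < length as" for i
  proof -
    have "{a \<in> A. a \<le> as ! i} = (!) as ` {..i}"
    proof safe
      fix a assume "a \<in> A" "a \<le> as ! i"
      then obtain k where "k < length as" "a = as ! k" using as(2) by (metis in_set_conv_nth)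
      moreover have "k \<le> i"
        using \<open>a \<le> as ! i\<close> calculation sorted_wrt_nth_less[OF as(1), of i k]
        by (meson leD not_less)
      ultimately show "a \<in> (!) as ` {..i}" by auto
    next
      fix k assume "k \<le> i"
      then show "as ! k \<in> A" using that as(2) by auto
      show "as ! k \<le> as ! i" using \<open>k \<le> i\<close> that sorted_wrt_nth_less[OF as(1), of k i]
        by (cases "k = i") auto
    qed
    moreover have "inj_on ((!) as) {..i}"
      using that fin by (auto simp: inj_on_def as_def nth_eq_iff_index_eq)
    ultimately show ?thesis by (simp add: relabel_def card_image)
  qed
  then have upt: "[1..<Suc (card A)] = map (relabel A) as"
    by (intro nth_equalityI) (auto simp: as simp del: upt_Suc)
  have "distinct (map (relabel A) as)" unfolding upt[symmetric] by simp
  then have inj: "inj_on (relabel A) A" by (simp add: distinct_map as)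
  have "level (relabel A ` S) (map (relabel A) w) (relabel A a) = level S w a" if "a \<in> A" for a
  proof -
    have "relabel A a \<in> relabel A ` S \<longleftrightarrow> a \<in> S"
      using inj that by (auto simp: A_def inj_on_def)
    moreover have "relabel A (w ! (t - 1)) = relabel A a \<longleftrightarrow> w ! (t - 1) = a"
      if "t \<in> {1..length w}" for t
    proof -
      have "w ! (t - 1) \<in> A" using that by (auto simp: A_def)
      then show ?thesis using inj \<open>a \<in> A\<close> by (auto dest: inj_onD)
    qed
    ultimately show ?thesis by (auto simp: level_def)
  qed
  then have "monomial_comp S w = map (level S w) as"
    unfolding monomial_comp_def Let_def A_def[symmetric] upt
    using as(2) by (simp add: level_def)
  moreover have "filter (\<lambda>r. r \<in> A) [1..<Suc N] = as"
  proof -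
    let ?ys = "filter (\<lambda>r. r \<in> A) [1..<Suc N]"
    have "set ?ys = A" using assms by (auto simp: A_def)
    then show ?thesis
      unfolding as_def
      using sorted_list_of_set.idem_if_sorted_distinct[of ?ys]
      by (simp add: sorted_wrt_filter del: upt_Suc)
  qed
  ultimately show ?thesis
    by (simp add: levels_def filter_map o_def level_empty_iff A_def del: upt_Suc)
qed

lemma coeff_sum: "coeff (\<Sum>a\<in>A. f a) S w = (\<Sum>a\<in>A. coeff (f a) S w)"
  by (induction A rule: infinite_finite_induct)
    (simp_all add: zero_superseries.rep_eq plus_superseries.rep_eq)

lemma coeff_sign: "coeff ((- 1) ^ e * f) S w = (- 1) ^ e * coeff f S w"
  by (cases "even e") (simp_all add: uminus_superseries.rep_eq)

text \<open>The monomial occurs in \<open>M J\<close> for exactly one \<open>J\<close>, namely its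
  own composition, so its coefficient tests whether this \<open>J\<close> lies above
  \<open>I\<close>.\<close>

lemma coeff_Q:
  assumes "\<forall>B\<in>set I. finite B \<and> B \<noteq> {}" "S \<union> set w \<subseteq> {1..N}"
  shows "coeff (Q I) S w = (if segmented I (levels N S w) then 1 else 0)"
proof -
  have "finite S" using assms(2) by (auto intro: finite_subset)
  then have "is_monomial S w" using assms(2) by (auto simp: is_monomial_def)
  then have "coeff (Q I) S w = (\<Sum>J | preceq I J. if J = monomial_comp S w then 1 else 0)"
    unfolding Q_def coeff_sum M.rep_eq by (intro sum.cong) auto
  also have "\<dots> = (if preceq I (monomial_comp S w) then 1 else 0)"
    by (simp add: finite_preceq)
  finally show ?thesis
    using assms by (simp add: monomial_comp_levels preceq_iff_segmented)
qed

lemma coeff_not_monomial: "\<not> is_monomial S w \<Longrightarrow> coeff f S w = 0"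
  using coeff[of f] by auto

lemma mem_level:
  "x \<in> level S w r \<longleftrightarrow> (if x = 0 then r \<in> S else x \<le> length w \<and> w ! (x - 1) = r)"
  by (auto simp: level_def)

text \<open>This recovers the length of a word from its levels, which is how the cut of a
  factorization is shown to lie at \<open>n\<close>.\<close>

lemma positive_levels:
  assumes "set w \<subseteq> {1..N}"
  shows "\<Union>(set (levels N S w)) - {0} = {1..length w}"
proof -
  have "w ! (x - 1) \<in> {1..N}" if "x \<in> {1..length w}" for x
    using assms that by (auto simp: subset_iff)
  then show ?thesis
    by (force simp: levels_def mem_level simp del: upt_Suc)
qed

text \<open>For pulling segmentations back: from shifted blocks to the original ones, and from the
  unions of runs to the runs themselves.\<close>

lemma concat_eq_map:
  "concat yss = map g xs \<Longrightarrow> \<exists>xss. concat xss = xs \<and> map (map g) xss = yss"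
proof (induction yss arbitrary: xs)
  case (Cons ys yss)
  then obtain us vs where *: "xs = us @ vs" "ys = map g us" "concat yss = map g vs"
    by (auto simp: append_eq_map_conv)
  then obtain xss where "concat xss = vs" "map (map g) xss = yss" using Cons.IH by blast
  then show ?case using * by (intro exI[of _ "us # xss"]) auto
qed auto

lemma concat_map_concat: "concat (map concat xsss) = concat (concat xsss)"
  by (induction xsss) auto

section \<open>Segmentations under increasing maps and shifts\<close>

lemma good_image:
  assumes "strict_mono f" "f 0 = (0::nat)"
  shows "good (map ((`) f) s) \<longleftrightarrow> good s"
proof -
  have "set_less (f ` B) (f ` C) \<longleftrightarrow> set_less B C" for B C
    using strict_mono_less[OF assms(1)] by (auto simp: set_less_def)
  moreover have "0 \<in> f ` B \<longleftrightarrow> 0 \<in> B" for B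
    using strict_mono_eq[OF assms(1)] assms(2) by (metis image_iff)
  ultimately show ?thesis by (auto simp: good_def sorted_wrt_map)
qed

lemma unions_image: "unions (map (map ((`) f)) Ss) = map ((`) f) (unions Ss)"
  by (simp add: image_Union)

text \<open>A strictly increasing map fixing 0 keeps comparisons of blocks and fermionic marks, and
  it is injective on sets, so segmentations transport in both directions.\<close>

lemma segmented_image:
  assumes "strict_mono f" "f 0 = 0"
  shows "segmented (map ((`) f) J) (map ((`) f) G) \<longleftrightarrow> segmented J G"
proof
  assume "segmented (map ((`) f) J) (map ((`) f) G)"
  then obtain Ts where Ts: "concat Ts = map ((`) f) J" "unions Ts = map ((`) f) G"
    "\<forall>s\<in>set Ts. good s" by (auto simp: segmented_def)
  then obtain Ss where Ss: "concat Ss = J" "map (map ((`) f)) Ss = Ts"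
    using concat_eq_map by blast
  have "inj ((`) f)" using strict_mono_imp_inj_on[OF assms(1)] inj_image_eq_iff injI by metis
  moreover have "map ((`) f) (unions Ss) = map ((`) f) G"
    using Ts(2) Ss(2) unions_image by metis
  ultimately have "unions Ss = G" by (metis inj_map_eq_map)
  then show "segmented J G"
    using Ss Ts(3) by (auto simp: segmented_def good_image[OF assms])
next
  assume "segmented J G"
  then obtain Ss where Ss: "concat Ss = J" "unions Ss = G" "\<forall>s\<in>set Ss. good s"
    by (auto simp: segmented_def)
  then have "concat (map (map ((`) f)) Ss) = map ((`) f) J"
    "unions (map (map ((`) f)) Ss) = map ((`) f) G"
    by (auto simp only: map_concat unions_image)
  then show "segmented (map ((`) f) J) (map ((`) f) G)"
    using Ss(3) unfolding segmented_def
    by (intro exI[of _ "map (map ((`) f)) Ss"]) (auto simp: good_image[OF assms])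
qed

definition shift_elem :: "nat \<Rightarrow> nat \<Rightarrow> nat" where
  "shift_elem n a = (if a = 0 then 0 else a + n)"

lemma shift_eq: "shift n J = map ((`) (shift_elem n)) J"
  by (simp add: shift_def shift_elem_def)

lemma mem_shift_elem:
  "x \<in> shift_elem n ` A \<longleftrightarrow> (if x = 0 then 0 \<in> A else n < x \<and> x - n \<in> A)"
proof (cases "x = 0")
  case False
  have "x \<in> shift_elem n ` A" if "n < x" "x - n \<in> A"
    using that by (intro image_eqI[of _ _ "x - n"]) (auto simp: shift_elem_def)
  then show ?thesis using False by (auto simp: shift_elem_def split: if_splits)
qed (auto simp: shift_elem_def image_iff)

lemma strict_mono_shift_elem: "strict_mono (shift_elem n)"
  by (auto simp: strict_mono_def shift_elem_def)

lemma shift_elem_0: "shift_elem n 0 = 0"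
  by (simp add: shift_elem_def)

section \<open>Signs\<close>

text \<open>On a common level the blocks of the first factor come first: both kinds of merger have
  this shape, and so has every increasing run, as the shifted elements are larger.\<close>

definition arrange :: "nat set list \<Rightarrow> nat set list \<Rightarrow> arrangement" where
  "arrange s t = map Inl s @ map Inr t"

text \<open>The indices are shifted by one, as the entry \<open>P ! i\<close> belongs to the variables with index \<open>Suc i\<close>.\<close>

definition levels_left :: "(nat set list \<times> nat set list) list \<Rightarrow> nat set" where
  "levels_left P = {Suc i | i. i < length P \<and> 0 \<in> \<Union>(set (fst (P ! i)))}"

definition levels_right :: "(nat set list \<times> nat set list) list \<Rightarrow> nat set" where
  "levels_right P = {Suc i | i. i < length P \<and> 0 \<in> \<Union>(set (snd (P ! i)))}"

text \<open>The number of new inversions caused by appending one fermionic block of the first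
  factor.\<close>

definition count_right :: "arrangement \<Rightarrow> nat" where
  "count_right L = length (filter (\<lambda>x. \<exists>B. x = Inr B \<and> 0 \<in> B) L)"

text \<open>All new pairs have the appended block as their second member, so only a fermionic
  \<open>Inl\<close> block adds any.\<close>

lemma eps_snoc:
  "eps (L @ [x]) = eps L + (if \<exists>B. x = Inl B \<and> 0 \<in> B then count_right L else 0)"
proof -
  let ?X = "\<lambda>L. {(p, q). p < q \<and> q < length L \<and>
     (\<exists>B C. L ! p = Inr B \<and> L ! q = Inl C \<and> 0 \<in> B \<and> 0 \<in> C)} :: (nat \<times> nat) set"
  let ?Y = "{p. p < length L \<and> (\<exists>B. L ! p = Inr B \<and> 0 \<in> B) \<and> (\<exists>C. x = Inl C \<and> 0 \<in> C)}"
  have "?X (L @ [x]) = ?X L \<union> (\<lambda>p. (p, length L)) ` ?Y"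
    by (auto simp: nth_append less_Suc_eq split: if_splits)
  moreover have "finite (?X L)"
    by (rule finite_subset[of _ "{..<length L} \<times> {..<length L}"]) auto
  moreover have "?X L \<inter> (\<lambda>p. (p, length L)) ` ?Y = {}" by auto
  ultimately have "eps (L @ [x]) = eps L + card ((\<lambda>p. (p, length L)) ` ?Y)"
    unfolding eps_def by (simp add: card_Un_disjoint)
  also have "card ((\<lambda>p. (p, length L)) ` ?Y) = card ?Y"
    by (rule card_image) (auto simp: inj_on_def)
  finally show ?thesis
    by (auto simp: count_right_def length_filter_conv_card)
qed

lemma eps_append_Inl:
  "eps (L @ map Inl s) = eps L + count_right L * length (filter (\<lambda>B. 0 \<in> B) s)"
proof (induction s rule: rev_induct)
  case (snoc B s)
  have "eps (L @ map Inl (s @ [B])) = eps ((L @ map Inl s) @ [Inl B])" by simp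
  also have "\<dots> = eps (L @ map Inl s) + (if 0 \<in> B then count_right L else 0)"
    by (subst eps_snoc) (simp add: count_right_def)
  finally show ?case using snoc by simp
qed simp

lemma eps_append_Inr: "eps (L @ map Inr t) = eps L"
proof (induction t rule: rev_induct)
  case (snoc B t)
  have "eps (L @ map Inr (t @ [B])) = eps ((L @ map Inr t) @ [Inr B])" by simp
  then show ?case using snoc by (simp only: eps_snoc) simp
qed simp

text \<open>Inside \<open>arrange s t\<close> no inversion occurs; the new ones pair a fermionic
  block of \<open>s\<close> with one already in \<open>L\<close>.\<close>

lemma eps_append_arrange:
  "eps (L @ arrange s t) = eps L + count_right L * length (filter (\<lambda>B. 0 \<in> B) s)"
  using eps_append_Inr[of "L @ map Inl s" t] by (simp add: arrange_def eps_append_Inl)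

lemma count_right_append_arrange:
  "count_right (L @ arrange s t) = count_right L + length (filter (\<lambda>B. 0 \<in> B) t)"
  by (simp add: count_right_def arrange_def filter_map o_def)

lemma indices_snoc:
  "{Suc i | i. i < length (P @ [p]) \<and> X ((P @ [p]) ! i)} =
    {Suc i | i. i < length P \<and> X (P ! i)} \<union> (if X p then {Suc (length P)} else {})"
proof -
  have "(\<exists>i. r = Suc i \<and> i < length (P @ [p]) \<and> X ((P @ [p]) ! i)) \<longleftrightarrow>
      (\<exists>i. r = Suc i \<and> i < length P \<and> X (P ! i)) \<or> r = Suc (length P) \<and> X p" for r
    by (cases r) (auto simp: nth_append less_Suc_eq)
  then show ?thesis by auto
qed

lemma levels_left_snoc:
  "levels_left (P @ [p]) =
    levels_left P \<union> (if 0 \<in> \<Union>(set (fst p)) then {Suc (length P)} else {})"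
  unfolding levels_left_def by (rule indices_snoc)

lemma levels_right_snoc:
  "levels_right (P @ [p]) =
    levels_right P \<union> (if 0 \<in> \<Union>(set (snd p)) then {Suc (length P)} else {})"
  unfolding levels_right_def by (rule indices_snoc)

lemma levels_left_subset: "levels_left P \<subseteq> {1..length P}"
  and levels_right_subset: "levels_right P \<subseteq> {1..length P}"
  by (auto simp: levels_left_def levels_right_def)

lemma theta_sign_less: "\<forall>s\<in>S. \<forall>t\<in>T. s < t \<Longrightarrow> theta_sign S T = 1"
proof -
  assume "\<forall>s\<in>S. \<forall>t\<in>T. s < t"
  then have "{(s, t). s \<in> S \<and> t \<in> T \<and> t < s} = {}"
    by (auto dest: less_asym)
  then show ?thesis by (simp only: theta_sign_def) simp
qed

lemma theta_sign_greater: "\<forall>t\<in>T. t < s \<Longrightarrow> theta_sign {s} T = (-1) ^ card T"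
proof -
  assume "\<forall>t\<in>T. t < s"
  then have "{(s', t). s' \<in> {s} \<and> t \<in> T \<and> t < s'} = Pair s ` T" by auto
  moreover have "card (Pair s ` T) = card T" by (rule card_image) (auto simp: inj_on_def)
  ultimately show ?thesis by (simp only: theta_sign_def)
qed

text \<open>Add the levels one at a time. A new theta from the left factor has to pass all earlier
  thetas from the right factor, and these correspond to the new inversions of fermionic
  blocks.\<close>

lemma sign_arrange:
  assumes "\<forall>(s, t)\<in>set P. good s \<and> good t \<and> \<not> (0 \<in> \<Union>(set s) \<and> 0 \<in> \<Union>(set t))"
  shows "theta_sign (levels_left P) (levels_right P) = (-1) ^ eps (concat (map (case_prod arrange) P))"
proof -
  \<comment> \<open>The claim on \<open>count_right\<close> is carried along because it supplies the
    sign change of the next step.\<close>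
  have "theta_sign (levels_left P) (levels_right P) = (-1) ^ eps (concat (map (case_prod arrange) P)) \<and>
      count_right (concat (map (case_prod arrange) P)) = card (levels_right P)"
    using assms
  proof (induction P rule: rev_induct)
    case Nil
    then show ?case by (simp add: levels_left_def levels_right_def eps_def count_right_def)
  next
    case (snoc p P)
    obtain s t where p: "p = (s, t)" by (cases p)
    let ?L = "concat (map (case_prod arrange) P)"
    have st: "good s" "good t" "\<not> (0 \<in> \<Union>(set s) \<and> 0 \<in> \<Union>(set t))"
      using snoc.prems p by auto
    have IH: "theta_sign (levels_left P) (levels_right P) = (-1) ^ eps ?L"
      "count_right ?L = card (levels_right P)" using snoc by auto
    have fin: "finite (levels_left P)" "finite (levels_right P)"
      using levels_left_subset levels_right_subset by (meson finite_atLeastAtMost finite_subset)+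
    have lt: "\<forall>r\<in>levels_left P. r < Suc (length P)" "\<forall>r\<in>levels_right P. r < Suc (length P)"
      using levels_left_subset[of P] levels_right_subset[of P] by auto
    let ?N = "Suc (length P)"
    have new: "?N \<notin> levels_left P" "?N \<notin> levels_right P" using lt by auto
    \<comment> \<open>The new index \<open>?N\<close> exceeds all earlier ones: on the left it costs
      one sign per right index, on the right none.\<close>
    have "theta_sign (levels_left P \<union> {?N}) (levels_right P) =
        theta_sign (levels_left P) (levels_right P) * (-1) ^ card (levels_right P)"
      using new fin lt by (subst theta_sign_Un_left) (auto simp: theta_sign_greater)
    moreover have "theta_sign (levels_left P) (levels_right P \<union> {?N}) =
        theta_sign (levels_left P) (levels_right P)"
      using new fin lt by (subst theta_sign_Un_right) (auto simp: theta_sign_less)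
    ultimately have "theta_sign (levels_left (P @ [p])) (levels_right (P @ [p])) =
        (-1) ^ eps (?L @ arrange s t)"
      using st unfolding levels_left_snoc levels_right_snoc
      by (auto simp: p IH eps_append_arrange length_filter_good power_add)
    moreover have "count_right (?L @ arrange s t) = card (levels_right (P @ [p]))"
      using st fin new
      by (simp add: p IH count_right_append_arrange length_filter_good levels_right_snoc)
    ultimately show ?case by (simp add: p)
  qed
  then show ?thesis by simp
qed

section \<open>Joint segmentations\<close>

text \<open>The blocks of \<open>K\<close> on one level. The order can still merge an increasing run
  of non-fermionic blocks, so these stay separate; it never merges a fermionic block, so that merger
  has to take place in \<open>K\<close> itself.\<close>

definition merge :: "nat set list \<Rightarrow> nat set list \<Rightarrow> nat set list" where
  "merge s t = (if s \<noteq> [] \<and> t \<noteq> [] \<and> 0 \<in> \<Union>(set s) \<union> \<Union>(set t)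
    then [\<Union>(set s) \<union> \<Union>(set t)] else s @ t)"

text \<open>Each \<open>P\<close> stands for one term of the product: entry \<open>i\<close> holds
  the segments of both factors that make up \<open>G ! i\<close>. They are not both fermionic
  because the square of a theta variable vanishes.\<close>

definition joint_segmentations ::
    "nat set list \<Rightarrow> nat set list \<Rightarrow> nat set list \<Rightarrow> (nat set list \<times> nat set list) list set" where
  "joint_segmentations I J G = {P. concat (map fst P) = I \<and> concat (map snd P) = J \<and>
     map (\<lambda>(s, t). \<Union>(set s) \<union> \<Union>(set t)) P = G \<and>
     (\<forall>(s, t)\<in>set P. good s \<and> good t \<and> \<not> (0 \<in> \<Union>(set s) \<and> 0 \<in> \<Union>(set t)))}"

lemma block_simps [simp]: "block (Inl B) = B" "block (Inr B) = B"
  by (simp_all add: block_def)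

section \<open>Arrangements and their runs\<close>

lemma unmerged_runs:
  "concat (map (\<lambda>x. [x]) L) = L" "map (\<lambda>R. \<Union>(block ` set R)) (map (\<lambda>x. [x]) L) = map block L"
  by (induction L) auto

lemma set_arrange: "set (arrange s t) = Inl ` set s \<union> Inr ` set t"
  by (simp add: arrange_def)

lemma Union_block_arrange: "\<Union>(block ` set (arrange s t)) = \<Union>(set s) \<union> \<Union>(set t)"
  by (auto simp: set_arrange)

lemma map_block_arrange: "map block (arrange s t) = s @ t"
  by (simp add: arrange_def o_def)

lemma Union_merge: "\<Union>(set (merge s t)) = \<Union>(set s) \<union> \<Union>(set t)"
  by (auto simp: merge_def)

lemma mem_shuffles_iff:
  "L \<in> shuffles (map Inl I) (map Inr J) \<longleftrightarrow>
    filter isl L = map Inl I \<and> filter (\<lambda>x. \<not> isl x) L = map Inr J"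
proof
  assume L: "L \<in> shuffles (map Inl I) (map Inr J)"
  then have "filter isl L \<in> shuffles (filter isl (map Inl I)) (filter isl (map Inr J))"
    "filter (\<lambda>x. \<not> isl x) L \<in> shuffles (filter (\<lambda>x. \<not> isl x) (map Inl I)) (filter (\<lambda>x. \<not> isl x) (map Inr J))"
    unfolding filter_shuffles[symmetric] by auto
  then show "filter isl L = map Inl I \<and> filter (\<lambda>x. \<not> isl x) L = map Inr J"
    by (simp add: filter_map o_def)
next
  assume "filter isl L = map Inl I \<and> filter (\<lambda>x. \<not> isl x) L = map Inr J"
  then show "L \<in> shuffles (map Inl I) (map Inr J)"
    using partition_in_shuffles[of L isl] by simp
qed

lemma filter_arrange:
  "filter isl (arrange s t) = map Inl s" "filter (\<lambda>x. \<not> isl x) (arrange s t) = map Inr t"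
  by (simp_all add: arrange_def filter_map o_def)

lemma filter_concat_arrange:
  "filter isl (concat (map (case_prod arrange) P)) = map Inl (concat (map fst P))"
  "filter (\<lambda>x. \<not> isl x) (concat (map (case_prod arrange) P)) = map Inr (concat (map snd P))"
  by (induction P) (auto simp: filter_arrange)

lemma concat_arrange_in_shuffles:
  "concat (map (case_prod arrange) P) \<in> shuffles (map Inl I) (map Inr J) \<longleftrightarrow>
    concat (map fst P) = I \<and> concat (map snd P) = J"
  by (simp add: mem_shuffles_iff filter_concat_arrange inj_map_eq_map)

lemma inj_arrange: "inj (case_prod arrange)"
proof (rule injI)
  fix p q assume "case_prod arrange p = case_prod arrange q"
  then have "map Inl (fst p) = (map Inl (fst q) :: arrangement)"
    "map Inr (snd p) = (map Inr (snd q) :: arrangement)"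
    by (metis (no_types) filter_arrange case_prod_beta)+
  then show "p = q" by (simp add: inj_map_eq_map prod_eq_iff)
qed

lemma produces_append: "produces L K \<Longrightarrow> produces L' K' \<Longrightarrow> produces (L @ L') (K @ K')"
  unfolding produces_def by (elim exE conjE, rule_tac x = "Rs @ Rsa" in exI) auto

lemma produces_concat:
  "\<forall>p\<in>set P. produces (f p) (g p) \<Longrightarrow> produces (concat (map f P)) (concat (map g P))"
proof (induction P)
  case Nil
  show ?case by (simp add: produces_def)
qed (auto intro: produces_append)

text \<open>If the level is fermionic and both parts are present, the fermionic part is a single
  block and the other an increasing run, so together they form one permitted merger. Otherwise
  nothing is merged.\<close>

lemma produces_arrange:
  assumes "good s" "good t" "\<not> (0 \<in> \<Union>(set s) \<and> 0 \<in> \<Union>(set t))"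
    and fin: "\<forall>B\<in>set s \<union> set t. finite B \<and> B \<noteq> {}"
  shows "produces (arrange s t) (merge s t)"
proof (cases "s \<noteq> [] \<and> t \<noteq> [] \<and> 0 \<in> \<Union>(set s) \<union> \<Union>(set t)")
  case True
  have "mergeable (arrange s t)"
  proof (cases "0 \<in> \<Union>(set s)")
    case 0: True
    then obtain F where "s = [F]" "0 \<in> F" using good_with_0 assms(1) by blast
    moreover have "increasing t" using assms 0 by (subst increasing_iff) (auto simp: good_without_0)
    ultimately show ?thesis using True by (auto simp: mergeable_def arrange_def)
  next
    case 0: False
    then obtain F where "t = [F]" "0 \<in> F" using good_with_0 assms(2) True by blast
    moreover have "increasing s" using assms 0 by (subst increasing_iff) (auto simp: good_without_0)
    ultimately show ?thesis using True by (auto simp: mergeable_def arrange_def)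
  qed
  then show ?thesis
    using True unfolding produces_def merge_def
    by (intro exI[of _ "[arrange s t]"]) (simp add: Union_block_arrange)
next
  case False
  then have "merge s t = map block (arrange s t)" by (auto simp: merge_def map_block_arrange)
  then show ?thesis
    unfolding produces_def
    by (intro exI[of _ "map (\<lambda>x. [x]) (arrange s t)"]) (simp add: unmerged_runs[unfolded map_map])
qed

lemma produces_nonempty:
  assumes "produces L K" "\<forall>x\<in>set L. finite (block x) \<and> block x \<noteq> {}" "B \<in> set K"
  shows "finite B \<and> B \<noteq> {}"
proof -
  obtain Rs where Rs: "concat Rs = L" "\<forall>R\<in>set Rs. length R = 1 \<or> mergeable R"
    "K = map (\<lambda>R. \<Union>(block ` set R)) Rs" using assms(1) by (auto simp: produces_def)
  then obtain R where R: "R \<in> set Rs" "B = \<Union>(block ` set R)" using assms(3) by auto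
  have "length R = 1 \<or> mergeable R" using Rs(2) R(1) by blast
  then have "R \<noteq> []" by (auto simp: mergeable_def)
  then obtain x where "x \<in> set R" by (cases R) auto
  moreover have "set R \<subseteq> set L" using Rs(1) R(1) by auto
  ultimately show ?thesis using assms(2) R(2) by blast
qed

section \<open>Super-shuffles matched with joint segmentations\<close>

lemma sorted_wrt_shuffles:
  assumes "zs \<in> shuffles xs ys" "sorted_wrt P xs" "sorted_wrt P ys"
    "\<forall>x\<in>set xs. \<forall>y\<in>set ys. P x y \<and> P y x"
  shows "sorted_wrt P zs"
  using assms
proof (induction xs ys arbitrary: zs rule: shuffles.induct)
  case (3 x xs y ys)
  then consider zs' where "zs = x # zs'" "zs' \<in> shuffles xs (y # ys)"
    | zs' where "zs = y # zs'" "zs' \<in> shuffles (x # xs) ys" by auto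
  then show ?case
  proof cases
    case 1
    then show ?thesis using 3 by (auto simp: set_shuffles)
  next
    case 2
    then show ?thesis using 3 by (auto simp: set_shuffles)
  qed
qed auto

text \<open>Here \<open>J\<close> is the second set supercomposition after the shift by \<open>n\<close>.\<close>

locale comp_pair =
  fixes n n' :: nat and I J :: "nat set list"
  assumes proper_left: "proper I" and proper_right: "proper J"
    and positive_left: "\<Union>(set I) - {0} = {1..n}"
    and positive_right: "\<Union>(set J) - {0} = {n + 1..n + n'}"
begin

lemma left_le: "B \<in> set I \<Longrightarrow> x \<in> B \<Longrightarrow> x \<le> n"
  using positive_left by (cases "x = 0") (auto simp: set_eq_iff)

lemma right_greater: "B \<in> set J \<Longrightarrow> x \<in> B \<Longrightarrow> x \<noteq> 0 \<Longrightarrow> n < x"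
  using positive_right by (auto simp: set_eq_iff Suc_le_eq)

lemma nonempty_left: "B \<in> set I \<Longrightarrow> finite B \<and> B \<noteq> {}"
  and nonempty_right: "B \<in> set J \<Longrightarrow> finite B \<and> B \<noteq> {}"
  using proper_left proper_right by (auto simp: proper_def)

text \<open>Positive elements are at most \<open>n\<close> on the left and above \<open>n\<close> on
  the right, so blocks of different origin share at most 0.\<close>

lemma proper_shuffle:
  assumes "L \<in> shuffles (map Inl I) (map Inr J)"
  shows "proper (map block L)"
proof -
  have "B \<inter> C \<subseteq> {0}" if "B \<in> set I" "C \<in> set J" for B C
    using left_le right_greater that by fastforce
  then have cross: "\<forall>x\<in>set (map Inl I). \<forall>y\<in>set (map Inr J).
      block x \<inter> block y \<subseteq> {0} \<and> block y \<inter> block x \<subseteq> {0}" by auto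
  have "sorted_wrt (\<lambda>x y. block x \<inter> block y \<subseteq> {0}) L"
    using proper_left proper_right
    by (intro sorted_wrt_shuffles[OF assms _ _ cross]) (simp_all add: proper_def sorted_wrt_map)
  moreover have "set L = Inl ` set I \<union> Inr ` set J"
    using set_shuffles[OF assms] by simp
  then have "finite (block x) \<and> block x \<noteq> {}" if "x \<in> set L" for x
    using that nonempty_left nonempty_right by (cases x) auto
  ultimately show ?thesis by (simp add: proper_def sorted_wrt_map)
qed

lemma joint_segmentationsD:
  assumes "P \<in> joint_segmentations I J G" "(s, t) \<in> set P"
  shows "good s" "good t" "\<not> (0 \<in> \<Union>(set s) \<and> 0 \<in> \<Union>(set t))"
    "set s \<subseteq> set I" "set t \<subseteq> set J"
proof -
  have "good s \<and> good t \<and> \<not> (0 \<in> \<Union>(set s) \<and> 0 \<in> \<Union>(set t))"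
    using assms unfolding joint_segmentations_def by blast
  then show "good s" "good t" "\<not> (0 \<in> \<Union>(set s) \<and> 0 \<in> \<Union>(set t))" by blast+
  have "concat (map fst P) = I" "concat (map snd P) = J"
    using assms(1) by (simp_all add: joint_segmentations_def)
  then show "set s \<subseteq> set I" "set t \<subseteq> set J" using assms(2) by force+
qed

text \<open>A non-fermionic level is an increasing run because the elements of \<open>s\<close> are
  at most \<open>n\<close> and those of \<open>t\<close> exceed \<open>n\<close>; a fermionic one
  with both parts present has become a single block.\<close>

lemma good_merge:
  assumes "good s" "good t" "set s \<subseteq> set I" "set t \<subseteq> set J"
  shows "good (merge s t)"
proof (cases "s = [] \<or> t = [] \<or> 0 \<in> \<Union>(set s) \<union> \<Union>(set t)")
  case True
  then show ?thesis using assms by (auto simp: merge_def)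
next
  case False
  have "set_less B C" if "B \<in> set s" "C \<in> set t" for B C
    unfolding set_less_def
  proof safe
    fix x y assume "x \<in> B" "y \<in> C"
    moreover have "y \<noteq> 0" using \<open>y \<in> C\<close> that False by auto
    ultimately show "x < y"
      using left_le[of B x] right_greater[of C y] that assms(3,4) by fastforce
  qed
  then have "good (s @ t)"
    using False assms(1,2) by (subst good_without_0) (auto simp: sorted_wrt_append good_without_0)
  then show ?thesis using False by (simp add: merge_def)
qed

text \<open>A non-fermionic block of \<open>J\<close> has only elements above \<open>n\<close>, so
  in an increasing run no block of \<open>I\<close> can follow it.\<close>

lemma sorted_arrange:
  assumes "set L \<subseteq> Inl ` set I \<union> Inr ` set J" "\<forall>x\<in>set L. 0 \<notin> block x"
    and "sorted_wrt set_less (map block L)"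
  shows "\<exists>s t. L = arrange s t"
  using assms
proof (induction L)
  case Nil
  then show ?case by (simp add: arrange_def)
next
  case (Cons x L)
  then obtain s t where L: "L = arrange s t" by auto
  show ?case
  proof (cases x)
    case (Inl b)
    then show ?thesis using L by (intro exI[of _ "b # s"] exI[of _ t]) (simp add: arrange_def)
  next
    case (Inr c)
    have "s = []"
    proof (rule ccontr)
      assume "s \<noteq> []"
      then obtain b where b: "Inl b \<in> set L" unfolding L set_arrange by (cases s) auto
      then have "set_less c b" using Cons.prems(3) Inr by force
      moreover have "b \<in> set I" "c \<in> set J" using Cons.prems(1) b Inr by auto
      moreover obtain u v where "u \<in> b" "v \<in> c"
        using nonempty_left[of b] nonempty_right[of c] calculation by auto
      moreover have "v \<noteq> 0" using Cons.prems(2) \<open>v \<in> c\<close> Inr by (cases v) auto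
      ultimately show False
        using left_le[of b u] right_greater[of c v] by (fastforce simp: set_less_def)
    qed
    then show ?thesis using L Inr by (intro exI[of _ "[]"] exI[of _ "c # t"]) (simp add: arrange_def)
  qed
qed

text \<open>The converse of \<open>produces_arrange\<close>: whatever runs make up one level of a
  super-shuffle, their blocks form one segment of each factor, and the mergers are those prescribed
  by \<open>merge\<close>.\<close>

lemma runs_of_level:
  assumes "\<forall>R\<in>set Rs. length R = 1 \<or> mergeable R"
    and "good (map (\<lambda>R. \<Union>(block ` set R)) Rs)"
    and L: "set (concat Rs) \<subseteq> Inl ` set I \<union> Inr ` set J"
  shows "\<exists>s t. concat Rs = arrange s t \<and> map (\<lambda>R. \<Union>(block ` set R)) Rs = merge s t \<and>
    good s \<and> good t \<and> \<not> (0 \<in> \<Union>(set s) \<and> 0 \<in> \<Union>(set t))"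
proof (cases "\<exists>R\<in>set Rs. mergeable R")
  case True
  then obtain R where R: "R \<in> set Rs" "mergeable R" by blast
  then have "0 \<in> \<Union>(block ` set R)" by (auto simp: mergeable_def)
  then have "0 \<in> \<Union>(set (map (\<lambda>R. \<Union>(block ` set R)) Rs))" using R(1) by auto
  \<comment> \<open>A merged run contains 0, and a good segment containing 0 is a single block;
    hence this run fills the whole level.\<close>
  from good_with_0[OF assms(2) this] have Rs: "Rs = [R]" using R(1) by auto
  from R(2) consider F Bs where "R = Inl F # map Inr Bs" "0 \<in> F" "Bs \<noteq> []" "increasing Bs"
    | F Bs where "R = map Inl Bs @ [Inr F]" "0 \<in> F" "Bs \<noteq> []" "increasing Bs"
    by (auto simp: mergeable_def)
  then show ?thesis
  proof cases
    case 1
    have "\<forall>B\<in>set Bs. finite B \<and> B \<noteq> {}" using L Rs 1 nonempty_right by auto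
    then have "good Bs" "0 \<notin> \<Union>(set Bs)" using 1 by (auto simp: increasing_iff good_def)
    then show ?thesis using 1 Rs
      by (intro exI[of _ "[F]"] exI[of _ Bs]) (auto simp: arrange_def merge_def)
  next
    case 2
    have "\<forall>B\<in>set Bs. finite B \<and> B \<noteq> {}" using L Rs 2 nonempty_left by auto
    then have "good Bs" "0 \<notin> \<Union>(set Bs)" using 2 by (auto simp: increasing_iff good_def)
    moreover have "concat Rs = arrange Bs [F]" "merge Bs [F] = [\<Union>(set Bs) \<union> F]"
      using 2 by (simp_all add: Rs arrange_def merge_def)
    moreover have "map (\<lambda>R. \<Union>(block ` set R)) Rs = [\<Union>(set Bs) \<union> F]"
      unfolding Rs 2(1) by (simp add: Un_commute)
    ultimately show ?thesis by (intro exI[of _ Bs] exI[of _ "[F]"]) simp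
  qed
next
  case False
  have "\<exists>x. R = [x]" if "R \<in> set Rs" for R
    using assms(1) False that by (auto simp: length_Suc_conv)
  then have "Rs = map (\<lambda>x. [x]) (concat Rs)" by (induction Rs) fastforce+
  then have U: "map (\<lambda>R. \<Union>(block ` set R)) Rs = map block (concat Rs)"
    using unmerged_runs(2) by metis
  show ?thesis
  proof (cases "0 \<in> \<Union>(set (map block (concat Rs)))")
    case True
    obtain F where F: "map block (concat Rs) = [F]"
      using good_with_0[OF assms(2)[unfolded U] True] by (elim exE conjE)
    then obtain x where x: "concat Rs = [x]" "block x = F" by auto
    show ?thesis
    proof (cases x)
      case (Inl B)
      then show ?thesis using x U
        by (intro exI[of _ "[B]"] exI[of _ "[]"]) (simp add: arrange_def merge_def)
    next
      case (Inr B)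
      then show ?thesis using x U
        by (intro exI[of _ "[]"] exI[of _ "[B]"]) (simp add: arrange_def merge_def)
    qed
  next
    case 0: False
    then have sorted: "sorted_wrt set_less (map block (concat Rs))"
      using assms(2) unfolding U by (simp only: good_without_0 not_False_eq_True)
    obtain s t where st: "concat Rs = arrange s t"
      using sorted_arrange[OF L _ sorted] 0 by auto
    have nz: "0 \<notin> \<Union>(set s)" "0 \<notin> \<Union>(set t)" and "sorted_wrt set_less (s @ t)"
      using 0 sorted unfolding st map_block_arrange by auto
    then have "good s" "good t" using good_without_0 unfolding sorted_wrt_append by blast+
    moreover have "map (\<lambda>R. \<Union>(block ` set R)) Rs = merge s t"
      unfolding U st map_block_arrange using nz by (simp only: merge_def Un_iff) simp
    ultimately show ?thesis using st nz by blast
  qed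
qed

text \<open>The arrangement and the levels determine the cut, and the tags then determine both
  segments; this gives injectivity. Conversely a segmentation of \<open>K\<close> groups the runs of
  \<open>L\<close> by level, and \<open>runs_of_level\<close> reads off the two segments of each
  group.\<close>

lemma bij_super_shuffles:
  "bij_betw (\<lambda>P. (concat (map (case_prod arrange) P), concat (map (case_prod merge) P)))
    (joint_segmentations I J G)
    {(L, K). L \<in> shuffles (map Inl I) (map Inr J) \<and> produces L K \<and> segmented K G}"
  (is "bij_betw ?f ?D ?E")
proof (rule bij_betwI')
  fix P P' assume P: "P \<in> ?D" "P' \<in> ?D"
  show "?f P = ?f P' \<longleftrightarrow> P = P'"
  proof
    assume "?f P = ?f P'"
    then have eq: "concat (map (case_prod arrange) P) = concat (map (case_prod arrange) P')" by simp
    have U: "map (\<lambda>a. \<Union>(block ` set a)) (map (case_prod arrange) P) = G" if "P \<in> ?D" for P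
      using that by (auto simp: joint_segmentations_def Union_block_arrange case_prod_beta o_def)
    \<comment> \<open>A level carries at most one fermionic block, so repeated blocks
      \<open>{0}\<close> cause no ambiguity in the cut.\<close>
    have zc: "length (filter (\<lambda>x. 0 \<in> block x) (arrange s t)) \<le> 1" if "P \<in> ?D" "(s, t) \<in> set P" for P s t
      using joint_segmentationsD(1-3)[OF that]
      by (simp add: arrange_def filter_map o_def length_filter_good del: Union_iff)
    have "concat (map (case_prod arrange) P) \<in> shuffles (map Inl I) (map Inr J)"
      using P(1) unfolding concat_arrange_in_shuffles joint_segmentations_def by blast
    then have "map (case_prod arrange) P = map (case_prod arrange) P'"
      using zc[OF P(1)] zc[OF P(2)]
      by (intro segmentation_unique[OF eq _ proper_shuffle])
        (simp_all only: U[OF P(1)] U[OF P(2)] set_map ball_Un ball_simps split_paired_Ball_Sigma, auto)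
    then show "P = P'" using inj_arrange by (metis inj_map_eq_map)
  qed simp
next
  fix P assume P: "P \<in> ?D"
  have "produces (arrange s t) (merge s t)" if "(s, t) \<in> set P" for s t
  proof (rule produces_arrange)
    show "\<forall>B\<in>set s \<union> set t. finite B \<and> B \<noteq> {}"
      using joint_segmentationsD(4,5)[OF P that] nonempty_left nonempty_right by blast
  qed (fact joint_segmentationsD(1-3)[OF P that])+
  then have "produces (concat (map (case_prod arrange) P)) (concat (map (case_prod merge) P))"
    by (intro produces_concat) auto
  moreover have "segmented (concat (map (case_prod merge) P)) G"
    unfolding segmented_def
  proof (intro exI conjI)
    show "unions (map (case_prod merge) P) = G"
      using P by (auto simp: joint_segmentations_def Union_merge case_prod_beta o_def)
    show "\<forall>s\<in>set (map (case_prod merge) P). good s"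
      using joint_segmentationsD[OF P] good_merge by auto
  qed simp
  ultimately show "?f P \<in> ?E"
    using P by (simp add: concat_arrange_in_shuffles joint_segmentations_def)
next
  fix y assume "y \<in> ?E"
  then obtain L K where y: "y = (L, K)" and L: "L \<in> shuffles (map Inl I) (map Inr J)"
    and K: "produces L K" "segmented K G" by auto
  let ?U = "\<lambda>R. \<Union>(block ` set R)"
  obtain Rs where Rs: "concat Rs = L" "\<forall>R\<in>set Rs. length R = 1 \<or> mergeable R"
    "K = map ?U Rs" using K(1) by (auto simp: produces_def)
  obtain Ss where Ss: "concat Ss = K" "unions Ss = G" "\<forall>s\<in>set Ss. good s"
    using K(2) by (auto simp: segmented_def)
  \<comment> \<open>Each entry of \<open>K\<close> is the union of a run, so the segments of
    \<open>K\<close> lift to groups of runs.\<close>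
  obtain Rss where Rss: "concat Rss = Rs" "map (map ?U) Rss = Ss"
    using concat_eq_map[of Ss ?U Rs] Ss(1) Rs(3) by auto
  have "\<exists>p. concat X = case_prod arrange p \<and> map ?U X = case_prod merge p \<and>
      good (fst p) \<and> good (snd p) \<and> \<not> (0 \<in> \<Union>(set (fst p)) \<and> 0 \<in> \<Union>(set (snd p)))"
    if "X \<in> set Rss" for X
  proof -
    have "set X \<subseteq> set Rs" using that Rss(1) by auto
    then have "set (concat X) \<subseteq> set L" unfolding Rs(1)[symmetric] by auto
    then have "set (concat X) \<subseteq> Inl ` set I \<union> Inr ` set J"
      using set_shuffles[OF L] by simp
    moreover have "good (map ?U X)" using Ss(3) that unfolding Rss(2)[symmetric] by simp
    moreover have "\<forall>R\<in>set X. length R = 1 \<or> mergeable R"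
      using Rs(2) \<open>set X \<subseteq> set Rs\<close> by blast
    ultimately obtain s t where "concat X = arrange s t" "map ?U X = merge s t"
      "good s" "good t" "\<not> (0 \<in> \<Union>(set s) \<and> 0 \<in> \<Union>(set t))"
      using runs_of_level[of X] by blast
    then show ?thesis by (intro exI[of _ "(s, t)"]) (simp only: case_prod_conv fst_conv snd_conv simp_thms)
  qed
  then obtain p where p: "\<And>X. X \<in> set Rss \<Longrightarrow> concat X = case_prod arrange (p X) \<and>
      map ?U X = case_prod merge (p X) \<and> good (fst (p X)) \<and> good (snd (p X)) \<and>
      \<not> (0 \<in> \<Union>(set (fst (p X))) \<and> 0 \<in> \<Union>(set (snd (p X))))" by metis
  let ?P = "map p Rss"
  have "concat (map (case_prod arrange) ?P) = concat (map concat Rss)"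
    by (intro arg_cong[of _ _ concat]) (simp add: p)
  also have "\<dots> = L" unfolding Rs(1)[symmetric] Rss(1)[symmetric] by (rule concat_map_concat)
  finally have fL: "concat (map (case_prod arrange) ?P) = L" .
  have mS: "map (case_prod merge) ?P = Ss" using Rss(2) by (auto simp: p)
  have "map (\<lambda>(s, t). \<Union>(set s) \<union> \<Union>(set t)) ?P = unions (map (case_prod merge) ?P)"
    by (simp add: Union_merge case_prod_beta)
  then have "?P \<in> ?D"
    using Ss(2) mS L p unfolding fL[symmetric] concat_arrange_in_shuffles
    by (auto simp: joint_segmentations_def case_prod_beta)
  moreover have "y = ?f ?P" using fL mS Ss(1) y by simp
  ultimately show "\<exists>P\<in>?D. y = ?f P" by blast
qed

section \<open>Factorizations of a fixed monomial\<close>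

context
  fixes N :: nat and R :: "nat set" and u :: "nat list"
  assumes R_u: "R \<union> set u \<subseteq> {1..N}"
begin

lemma nth_joint_segmentations:
  assumes "P \<in> joint_segmentations I J (levels N R u)" "i < N"
  shows "\<Union>(set (fst (P ! i))) \<union> \<Union>(set (snd (P ! i))) = level R u (Suc i)"
    and "(fst (P ! i), snd (P ! i)) \<in> set P"
proof -
  have eq: "map (\<lambda>(s, t). \<Union>(set s) \<union> \<Union>(set t)) P = levels N R u"
    using assms(1) by (simp add: joint_segmentations_def)
  then have len: "length P = N" by (metis length_levels length_map)
  show "\<Union>(set (fst (P ! i))) \<union> \<Union>(set (snd (P ! i))) = level R u (Suc i)"
    using arg_cong[OF eq, of "\<lambda>G. G ! i"] assms(2) len by (simp add: nth_levels case_prod_beta)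
  show "(fst (P ! i), snd (P ! i)) \<in> set P"
    using assms(2) len by simp
qed

text \<open>On each level the positive elements up to \<open>n\<close> come from \<open>I\<close>
  and the larger ones from \<open>J\<close>. So the two halves of a joint segmentation are the
  levels of \<open>take n u\<close> and, shifted, of \<open>drop n u\<close>, while the thetas split
  into \<open>levels_left P\<close> and its complement in \<open>R\<close>.\<close>

lemma
  assumes P: "P \<in> joint_segmentations I J (levels N R u)"
  shows n_le_length: "n \<le> length u"
    and levels_left_subset_R: "levels_left P \<subseteq> R"
    and levels_right_eq: "levels_right P = R - levels_left P"
    and unions_left: "unions (map fst P) = levels N (levels_left P) (take n u)"
    and unions_right: "unions (map snd P) =
      map ((`) (shift_elem n)) (levels N (R - levels_left P) (drop n u))"
proof -
  have "map (\<lambda>(s, t). \<Union>(set s) \<union> \<Union>(set t)) P = levels N R u" "concat (map fst P) = I"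
    using P by (auto simp: joint_segmentations_def)
  then have len: "length P = N" by (metis length_levels length_map)
  let ?s = "\<lambda>i. \<Union>(set (fst (P ! i)))" and ?t = "\<lambda>i. \<Union>(set (snd (P ! i)))"
  note lev = nth_joint_segmentations(1)[OF P]
  note inP = nth_joint_segmentations(2)[OF P]
  have s_le: "x \<le> n" if "x \<in> ?s i" "i < N" for x i
    using joint_segmentationsD(4)[OF P inP[OF that(2)]] that(1) left_le by blast
  have t_gt: "n < x" if "x \<in> ?t i" "i < N" "x \<noteq> 0" for x i
    using joint_segmentationsD(5)[OF P inP[OF that(2)]] that(1,3) right_greater by blast
  have both: "\<not> (0 \<in> ?s i \<and> 0 \<in> ?t i)" if "i < N" for i
    by (rule joint_segmentationsD(3)[OF P inP[OF that]])
  show "n \<le> length u"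
  proof (cases "n = 0")
    case False
    \<comment> \<open>The element \<open>n\<close> belongs to some level and is therefore a position
      of \<open>u\<close>.\<close>
    then have "n \<in> {1..n}" by simp
    then have "n \<in> \<Union>(set I)" using positive_left by blast
    then obtain p where "p \<in> set P" "n \<in> \<Union>(set (fst p))"
      unfolding \<open>concat (map fst P) = I\<close>[symmetric] by auto
    then obtain i where "i < N" "n \<in> ?s i" using len by (metis in_set_conv_nth)
    then have "n \<in> level R u (Suc i)" using lev by blast
    then show ?thesis using False by (simp add: mem_level)
  qed simp
  note n = this
  have left: "Suc i \<in> levels_left P \<longleftrightarrow> 0 \<in> ?s i" if "i < N" for i
    using that len by (simp add: levels_left_def)
  have right: "Suc i \<in> levels_right P \<longleftrightarrow> 0 \<in> ?t i" if "i < N" for i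
    using that len by (simp add: levels_right_def)
  have R: "Suc i \<in> R \<longleftrightarrow> 0 \<in> ?s i \<or> 0 \<in> ?t i" if "i < N" for i
    using lev[OF that] mem_level[of 0 R u "Suc i"] by auto
  have right': "Suc i \<in> levels_right P \<longleftrightarrow> Suc i \<in> R - levels_left P" if "i < N" for i
    using left[OF that] right[OF that] R[OF that] both[OF that] by blast
  have left': "Suc i \<in> levels_left P \<Longrightarrow> Suc i \<in> R" if "i < N" for i
    using left[OF that] R[OF that] by blast
  have range: "\<exists>i<N. r = Suc i" if "r \<in> {1..N}" for r
    using that by (cases r) auto
  show "levels_left P \<subseteq> R"
  proof
    fix r assume r: "r \<in> levels_left P"
    then have "r \<in> {1..N}" using levels_left_subset[of P] len by blast
    then show "r \<in> R" using range left' r by blast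
  qed
  show "levels_right P = R - levels_left P"
  proof (rule set_eqI)
    fix r
    show "r \<in> levels_right P \<longleftrightarrow> r \<in> R - levels_left P"
    proof (cases "r \<in> {1..N}")
      case True
      then show ?thesis using right' range by blast
    next
      case False
      then show ?thesis using levels_right_subset[of P] len R_u by blast
    qed
  qed
  show "unions (map fst P) = levels N (levels_left P) (take n u)"
  proof (rule nth_equalityI)
    fix i assume "i < length (unions (map fst P))"
    then have i: "i < N" using len by simp
    have "x \<in> ?s i \<longleftrightarrow> x \<in> level (levels_left P) (take n u) (Suc i)" for x
    proof (cases "x = 0")
      case True
      then show ?thesis using left[OF i] by (simp add: mem_level)
    next
      case False
      have "x \<in> ?s i \<longleftrightarrow> x \<le> n \<and> x \<in> level R u (Suc i)"
        unfolding lev[OF i, symmetric] using s_le[OF _ i] t_gt[OF _ i False] by (metis Un_iff leD)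
      then show ?thesis unfolding mem_level using False n by (simp only:) auto
    qed
    then have "?s i = level (levels_left P) (take n u) (Suc i)" by blast
    then show "unions (map fst P) ! i = levels N (levels_left P) (take n u) ! i"
      using i len by (simp add: nth_levels)
  qed (simp add: len)
  show "unions (map snd P) =
      map ((`) (shift_elem n)) (levels N (R - levels_left P) (drop n u))"
    (is "_ = map ((`) ?f) ?G")
  proof (rule nth_equalityI)
    fix i assume "i < length (unions (map snd P))"
    then have i: "i < N" using len by simp
    have "x \<in> ?t i \<longleftrightarrow> x \<in> ?f ` level (R - levels_left P) (drop n u) (Suc i)" for x
    proof (cases "x = 0")
      case True
      then show ?thesis using right[OF i] right'[OF i] by (simp add: mem_shift_elem mem_level)
    next
      case False
      have "x \<in> ?t i \<longleftrightarrow> n < x \<and> x \<in> level R u (Suc i)"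
        unfolding lev[OF i, symmetric] using s_le[OF _ i] t_gt[OF _ i False] by (metis Un_iff leD)
      then show ?thesis unfolding mem_shift_elem mem_level using False n by (simp only:) auto
    qed
    then have "?t i = ?f ` level (R - levels_left P) (drop n u) (Suc i)" by blast
    then show "unions (map snd P) ! i = map ((`) ?f) ?G ! i"
      using i len by (simp add: nth_levels)
  qed (simp add: len)
qed

text \<open>A contributing factorization must cut the word at \<open>n\<close>, and the
  segmentations of the two factors are then unique. Pairing them level by level gives the
  inverse.\<close>

lemma bij_factorizations:
  "bij_betw (\<lambda>P. (levels_left P, n)) (joint_segmentations I J (levels N R u))
    {(T, k). T \<subseteq> R \<and> k \<le> length u \<and> segmented I (levels N T (take k u)) \<and>
      segmented J (map ((`) (shift_elem n)) (levels N (R - T) (drop k u)))}"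
  (is "bij_betw ?f ?D ?E")
proof (rule bij_betwI')
  fix P P' assume P: "P \<in> ?D" "P' \<in> ?D"
  show "?f P = ?f P' \<longleftrightarrow> P = P'"
  proof
    assume "?f P = ?f P'"
    then have T: "levels_left P = levels_left P'" by simp
    have zc: "length (filter (\<lambda>B. 0 \<in> B) s) \<le> 1" if "good s" for s
      using that by (simp add: length_filter_good)
    have c: "concat (map fst P) = concat (map fst P')" "concat (map snd P) = concat (map snd P')"
      "concat (map fst P) = I" "concat (map snd P) = J"
      using P by (simp_all add: joint_segmentations_def)
    have g: "\<forall>a\<in>set (map fst P) \<union> set (map fst P'). length (filter (\<lambda>B. 0 \<in> B) a) \<le> 1"
      "\<forall>a\<in>set (map snd P) \<union> set (map snd P'). length (filter (\<lambda>B. 0 \<in> B) a) \<le> 1"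
      using joint_segmentationsD(1,2)[OF P(1)] joint_segmentationsD(1,2)[OF P(2)] zc by fastforce+
    have "map fst P = map fst P'"
      by (rule segmentation_unique[where h = "\<lambda>B. B"])
        (use c g proper_left unions_left[OF P(1)] unions_left[OF P(2)] T in simp_all)
    moreover have "map snd P = map snd P'"
      by (rule segmentation_unique[where h = "\<lambda>B. B"])
        (use c g proper_right unions_right[OF P(1)] unions_right[OF P(2)] T in simp_all)
    ultimately show "P = P'" by (metis zip_map_fst_snd)
  qed simp
next
  fix P assume P: "P \<in> ?D"
  have "segmented I (levels N (levels_left P) (take n u))"
    unfolding segmented_def unions_left[OF P, symmetric]
    using P joint_segmentationsD(1)[OF P]
    by (intro exI[of _ "map fst P"]) (auto simp: joint_segmentations_def)
  moreover have "segmented J (map ((`) (shift_elem n))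
      (levels N (R - levels_left P) (drop n u)))"
    unfolding segmented_def unions_right[OF P, symmetric]
    using P joint_segmentationsD(2)[OF P]
    by (intro exI[of _ "map snd P"]) (auto simp: joint_segmentations_def)
  ultimately show "?f P \<in> ?E"
    using n_le_length[OF P] levels_left_subset_R[OF P] by simp
next
  let ?sh = "shift_elem n"
  fix y assume "y \<in> ?E"
  then obtain T k where y: "y = (T, k)" and T: "T \<subseteq> R" and k: "k \<le> length u"
    and seg: "segmented I (levels N T (take k u))"
      "segmented J (map ((`) ?sh) (levels N (R - T) (drop k u)))" by auto
  obtain Ss where Ss: "concat Ss = I" "unions Ss = levels N T (take k u)" "\<forall>s\<in>set Ss. good s"
    using seg(1) by (auto simp: segmented_def)
  obtain Ts where Ts: "concat Ts = J" "unions Ts = map ((`) ?sh) (levels N (R - T) (drop k u))"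
    "\<forall>s\<in>set Ts. good s"
    using seg(2) by (auto simp: segmented_def)
  \<comment> \<open>The positive elements in the blocks of \<open>I\<close> are
    \<open>1, ..., n\<close> and those in the levels of \<open>take k u\<close> are
    \<open>1, ..., k\<close>; so the cut is at \<open>n\<close>.\<close>
  have "\<Union>(set I) = \<Union>(set (unions Ss))" unfolding Ss(1)[symmetric] by auto
  moreover have "set (take k u) \<subseteq> {1..N}" using R_u set_take_subset[of k u] by blast
  ultimately have "{1..n} = {1..length (take k u)}"
    using positive_left positive_levels Ss(2) by metis
  then have kn: "k = n" using k by (metis card_atLeastAtMost diff_Suc_1 length_take min.absorb2)
  have len: "length Ss = N" "length Ts = N"
    using arg_cong[OF Ss(2), of length] arg_cong[OF Ts(2), of length] by simp_all
  let ?P = "zip Ss Ts"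
  have s: "\<Union>(set (Ss ! i)) = level T (take n u) (Suc i)" if "i < N" for i
    using arg_cong[OF Ss(2), of "\<lambda>G. G ! i"] that len by (simp add: nth_levels kn)
  have t: "\<Union>(set (Ts ! i)) = ?sh ` level (R - T) (drop n u) (Suc i)" if "i < N" for i
    using arg_cong[OF Ts(2), of "\<lambda>G. G ! i"] that len by (simp add: nth_levels kn)
  have sh0: "0 \<in> ?sh ` A \<longleftrightarrow> 0 \<in> A" for A by (simp add: mem_shift_elem)
  \<comment> \<open>Cutting the word at \<open>n\<close> and shifting the positions of the second
    part back up restores each level.\<close>
  have "x \<in> level T (take n u) r \<union> ?sh ` level (R - T) (drop n u) r \<longleftrightarrow> x \<in> level R u r" for x r
    unfolding Un_iff mem_shift_elem mem_level using T k kn by auto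
  then have "level T (take n u) r \<union> ?sh ` level (R - T) (drop n u) r = level R u r" for r
    by (intro set_eqI)
  then have "map (\<lambda>(s, t). \<Union>(set s) \<union> \<Union>(set t)) ?P = levels N R u"
    using len by (intro nth_equalityI) (simp_all add: s t nth_levels)
  moreover have "good s \<and> good t \<and> \<not> (0 \<in> \<Union>(set s) \<and> 0 \<in> \<Union>(set t))" if "(s, t) \<in> set ?P" for s t
  proof -
    from that obtain i where i: "i < N" "s = Ss ! i" "t = Ts ! i"
      using len by (auto simp: in_set_conv_nth)
    have "\<not> (0 \<in> \<Union>(set s) \<and> 0 \<in> \<Union>(set t))"
      unfolding i(2,3) s[OF i(1)] t[OF i(1)] sh0 by (simp add: mem_level)
    moreover have "s \<in> set Ss" "t \<in> set Ts" using i len by simp_all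
    ultimately show ?thesis using Ss(3) Ts(3) by blast
  qed
  ultimately have "?P \<in> ?D"
    using Ss(1) Ts(1) len unfolding joint_segmentations_def by auto
  moreover have "levels_left ?P = T"
  proof (rule set_eqI)
    fix r
    show "r \<in> levels_left ?P \<longleftrightarrow> r \<in> T"
    proof (cases "r \<in> {1..N}")
      case True
      then obtain i where i: "i < N" "r = Suc i" by (cases r) auto
      have "0 \<in> \<Union>(set (Ss ! i)) \<longleftrightarrow> r \<in> T" unfolding s[OF i(1)] i(2) by (simp add: mem_level)
      then show ?thesis using i len by (simp add: levels_left_def)
    next
      case False
      then show ?thesis using levels_left_subset[of ?P] len T R_u by auto
    qed
  qed
  ultimately show "\<exists>P\<in>?D. y = ?f P" using y kn by auto
qed

text \<open>The two bijections turn both sums into sums over joint segmentations, and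
  \<open>sign_arrange\<close> matches the signs term by term.\<close>

lemma sum_factorizations_eq_sum_super_shuffles:
  "(\<Sum>(T, k) | T \<subseteq> R \<and> k \<le> length u \<and> segmented I (levels N T (take k u)) \<and>
      segmented J (map ((`) (shift_elem n)) (levels N (R - T) (drop k u))).
      theta_sign T (R - T)) =
    (\<Sum>(L, K) | L \<in> shuffles (map Inl I) (map Inr J) \<and> produces L K \<and> segmented K (levels N R u).
      (-1) ^ eps L)"
proof -
  let ?D = "joint_segmentations I J (levels N R u)"
  have "theta_sign (levels_left P) (R - levels_left P) =
      (-1) ^ eps (concat (map (case_prod arrange) P))" if "P \<in> ?D" for P
    using sign_arrange[of P] joint_segmentationsD(1-3)[OF that]
    unfolding levels_right_eq[OF that] by blast
  then have "(\<Sum>P\<in>?D. theta_sign (levels_left P) (R - levels_left P)) =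
      (\<Sum>P\<in>?D. (-1) ^ eps (concat (map (case_prod arrange) P)))"
    by (rule sum.cong[OF refl])
  then show ?thesis
    using sum.reindex_bij_betw[OF bij_factorizations, of "\<lambda>(T, k). theta_sign T (R - T)"]
      sum.reindex_bij_betw[OF bij_super_shuffles[of "levels N R u"],
        of "\<lambda>(L, K). (-1) ^ eps L :: rat"]
    by simp
qed

end

end

section \<open>Comparison of coefficients\<close>

lemma set_supercomposition_proper:
  assumes "set_supercomposition n m I"
  shows "proper I" "\<Union>(set I) - {0} = {1..n}"
proof -
  have "\<forall>B\<in>set I. B \<noteq> {} \<and> B \<subseteq> {0..n}"
    using assms by (simp add: set_supercomposition_def)
  then show "proper I"
    using assms unfolding proper_def sorted_wrt_iff_nth_less set_supercomposition_def
    by (auto intro: finite_subset)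
  show "\<Union>(set I) - {0} = {1..n}"
    using assms by (auto simp: set_supercomposition_def)
qed

lemma comp_pair_shift:
  assumes "set_supercomposition n m I" "set_supercomposition n' m' J"
  shows "comp_pair n n' I (shift n J)"
proof
  show "proper I" "\<Union>(set I) - {0} = {1..n}"
    using set_supercomposition_proper assms(1) by auto
  have "shift_elem n ` B \<inter> shift_elem n ` C \<subseteq> {0}" if "B \<inter> C \<subseteq> {0}" for B C
  proof -
    have "shift_elem n ` B \<inter> shift_elem n ` C = shift_elem n ` (B \<inter> C)"
      using strict_mono_shift_elem[THEN strict_mono_imp_inj_on] by (simp add: image_Int)
    then show ?thesis using that by (auto simp: shift_elem_0)
  qed
  then have "sorted_wrt (\<lambda>B C. shift_elem n ` B \<inter> shift_elem n ` C \<subseteq> {0}) J"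
    using set_supercomposition_proper(1)[OF assms(2)]
    by (simp add: proper_def sorted_wrt_iff_nth_less)
  then show "proper (shift n J)"
    using set_supercomposition_proper(1)[OF assms(2)]
    by (simp add: proper_def shift_eq sorted_wrt_map)
  have J: "x \<in> \<Union>(set J) \<and> x \<noteq> 0 \<longleftrightarrow> 1 \<le> x \<and> x \<le> n'" for x
    using set_supercomposition_proper(2)[OF assms(2)] by (simp add: set_eq_iff)
  have "\<Union>(set (shift n J)) = shift_elem n ` \<Union>(set J)"
    by (simp add: shift_eq image_Union)
  then have "x \<in> \<Union>(set (shift n J)) - {0} \<longleftrightarrow> x \<in> {n + 1..n + n'}" for x
    using J[of "x - n"] by (auto simp: mem_shift_elem simp del: Union_iff)
  then show "\<Union>(set (shift n J)) - {0} = {n + 1..n + n'}" by blast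
qed

theorem theorem5p3:
  fixes I J :: "nat set list" and n m n' m' :: nat
  assumes "set_supercomposition n m I"
    and "set_supercomposition n' m' J"
  shows "Q I * Q J = (\<Sum>(L, K)\<in>SSh n I J. (-1) ^ eps L * Q K)"
proof (rule superseries_eqI)
  fix R u
  interpret comp_pair n n' I "shift n J" by (rule comp_pair_shift[OF assms])
  have nonempty_J: "\<forall>B\<in>set J. finite B \<and> B \<noteq> {}"
    using set_supercomposition_proper(1)[OF assms(2)] by (simp add: proper_def)
  show "coeff (Q I * Q J) R u = coeff (\<Sum>(L, K)\<in>SSh n I J. (-1) ^ eps L * Q K) R u"
  proof (cases "is_monomial R u")
    case False
    then show ?thesis by (simp add: coeff_not_monomial)
  next
    case True
    \<comment> \<open>A bound on all indices in the monomial; inserting 0 keeps \<open>Max\<close>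
      meaningful for the monomial 1.\<close>
    define N where "N = Max (insert 0 (R \<union> set u))"
    have fin: "finite R" and R_u: "R \<union> set u \<subseteq> {1..N}"
      using True by (auto simp: is_monomial_def N_def Suc_le_eq intro!: Max_ge intro: gr0I)
    let ?E = "{(T, k). T \<subseteq> R \<and> k \<le> length u \<and> segmented I (levels N T (take k u)) \<and>
      segmented (shift n J) (map ((`) (shift_elem n)) (levels N (R - T) (drop k u)))}"
    \<comment> \<open>Both coefficients are 0 or 1; the test for \<open>J\<close> is moved to
      \<open>shift n J\<close> by \<open>segmented_image\<close>.\<close>
    have Q: "coeff (Q I) T (take k u) * coeff (Q J) (R - T) (drop k u) =
        (if (T, k) \<in> ?E then 1 else 0)" if "T \<subseteq> R" "k \<le> length u" for T k
    proof -
      have "T \<union> set (take k u) \<subseteq> {1..N}" "(R - T) \<union> set (drop k u) \<subseteq> {1..N}"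
        using R_u that set_take_subset[of k u] set_drop_subset[of k u] by blast+
      then show ?thesis
        using that nonempty_left nonempty_J
        by (simp add: coeff_Q shift_eq segmented_image[OF strict_mono_shift_elem shift_elem_0])
    qed
    have "coeff (Q I * Q J) R u = (\<Sum>T\<in>Pow R. \<Sum>k\<le>length u.
        if (T, k) \<in> ?E then theta_sign T (R - T) else 0)"
      unfolding times_superseries.rep_eq mult.assoc
      by (intro sum.cong refl) (subst Q, auto)
    also have "\<dots> = (\<Sum>p\<in>Pow R \<times> {..length u}.
        if p \<in> ?E then theta_sign (fst p) (R - fst p) else 0)"
      unfolding sum.cartesian_product
      by (intro sum.cong refl) (clarify, simp)
    also have "\<dots> = (\<Sum>(T, k)\<in>?E. theta_sign T (R - T))"
    proof (rule sum.mono_neutral_cong_right)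
      show "\<forall>p\<in>Pow R \<times> {..length u} - ?E. (if p \<in> ?E then theta_sign (fst p) (R - fst p) else 0) = 0"
        by (intro ballI if_not_P) blast
    qed (use fin in auto)
    also have "\<dots> = (\<Sum>(L, K) | L \<in> shuffles (map Inl I) (map Inr (shift n J)) \<and>
        produces L K \<and> segmented K (levels N R u). (-1) ^ eps L)"
      by (rule sum_factorizations_eq_sum_super_shuffles[OF R_u])
    \<comment> \<open>Back to all super-shuffles: those whose \<open>K\<close> has no segmentation
      into the levels contribute 0.\<close>
    also have "\<dots> = (\<Sum>p\<in>SSh n I J. if segmented (snd p) (levels N R u) then (-1) ^ eps (fst p) else 0)"
    proof (rule sum.mono_neutral_cong_left)
      show "finite (SSh n I J)" by (rule finite_SSh)
      show "\<forall>p\<in>SSh n I J - {(L, K). L \<in> shuffles (map Inl I) (map Inr (shift n J)) \<and>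
          produces L K \<and> segmented K (levels N R u)}.
          (if segmented (snd p) (levels N R u) then (-1) ^ eps (fst p) else 0) = (0 :: rat)"
        by (intro ballI if_not_P) (auto simp: SSh_def arrangements_def)
    qed (auto simp: SSh_def arrangements_def)
    also have "\<dots> = (\<Sum>p\<in>SSh n I J. coeff ((-1) ^ eps (fst p) * Q (snd p)) R u)"
    proof (intro sum.cong refl)
      fix p assume "p \<in> SSh n I J"
      then have "fst p \<in> shuffles (map Inl I) (map Inr (shift n J))" "produces (fst p) (snd p)"
        by (auto simp: SSh_def arrangements_def)
      moreover have "\<forall>x\<in>set (fst p). finite (block x) \<and> block x \<noteq> {}"
        using set_shuffles[OF calculation(1)] nonempty_left nonempty_right by auto
      ultimately have "\<forall>B\<in>set (snd p). finite B \<and> B \<noteq> {}" using produces_nonempty by blast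
      then show "(if segmented (snd p) (levels N R u) then (-1) ^ eps (fst p) else 0) =
          coeff ((-1) ^ eps (fst p) * Q (snd p)) R u"
        by (simp add: coeff_sign coeff_Q[OF _ R_u])
    qed
    also have "\<dots> = coeff (\<Sum>(L, K)\<in>SSh n I J. (-1) ^ eps L * Q K) R u"
      by (simp add: coeff_sum case_prod_beta)
    finally show ?thesis .
  qed
qed

end
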